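(* For every integer $n\ge 8$, $$\mathrm{ex}(n,K_3,\widehat P_4)=\left\lfloor \frac{n^2}{8}\right\rfloor .$$ Moreover, $\mathrm{ex}(4,K_3,\widehat P_4)=4$, $\mathrm{ex}(5,K_3,\widehat P_4)=4$, $\mathrm{ex}(6,K_3,\widehat P_4)=5$ and $\mathrm{ex}(7,K_3,\widehat P_4)=8$.
   Context: All graphs are finite and simple. $P_4$ denotes the path on $4$ vertices. For a graph $G$, its suspension $\widehat G$ is the graph obtained from $G$ by adding one new vertex and joining it to every vertex of $G$; thus $\widehat P_4$ is a $5$-vertex graph. For graphs $T$ and $H$, $\mathrm{ex}(n,T,H)$ denotes the maximum number of copies of $T$ in an $n$-vertex graph that contains no copy of $H$ as a (not necessarily induced) subgraph. $K_3$ is the triangle, so $\mathrm{ex}(n,K_3,\widehat P_4)$ is the maximum number of triangles in an $n$-vertex graph containing no subgraph isomorphic to $\widehat P_4$. *)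

theory Defs
  imports Main
begin

definition simple_graph :: "nat \<Rightarrow> nat set set \<Rightarrow> bool" where
  "simple_graph n E \<longleftrightarrow> (\<forall>e\<in>E. e \<subseteq> {..<n} \<and> card e = 2)"

definition triangles :: "nat \<Rightarrow> nat set set \<Rightarrow> nat set set" where
  "triangles n E = {T. T \<subseteq> {..<n} \<and> card T = 3 \<and> (\<forall>x\<in>T. \<forall>y\<in>T. x \<noteq> y \<longrightarrow> {x, y} \<in> E)}"

definition num_triangles :: "nat \<Rightarrow> nat set set \<Rightarrow> nat" where
  "num_triangles n E = card (triangles n E)"

definition contains_susp_P4 :: "nat \<Rightarrow> nat set set \<Rightarrow> bool" where
  "contains_susp_P4 n E \<longleftrightarrow>
     (\<exists>a p1 p2 p3 p4. {a, p1, p2, p3, p4} \<subseteq> {..<n} \<and> card {a, p1, p2, p3, p4} = 5 \<and>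
        {a, p1} \<in> E \<and> {a, p2} \<in> E \<and> {a, p3} \<in> E \<and> {a, p4} \<in> E \<and>
        {p1, p2} \<in> E \<and> {p2, p3} \<in> E \<and> {p3, p4} \<in> E)"

definition ex_K3_susp_P4 :: "nat \<Rightarrow> nat" where
  "ex_K3_susp_P4 n = Max {num_triangles n E | E. simple_graph n E \<and> \<not> contains_susp_P4 n E}"

end

theory Submission
  imports Defs
begin

text \<open>A vertex outside a \<open>K\<^sub>4\<close> has at most one neighbour in it, and a triangle lying in no \<open>K\<^sub>4\<close> has a
  vertex at which both of its edges lie in no other triangle. Keeping just these two edges of every
  such triangle gives a triangle-free graph, so by Mantel there are at most \<open>n\<^sup>2/8\<close> such triangles.
  Two disjoint \<open>K\<^sub>4\<close>s can be removed at the cost of at most \<open>2n - 8\<close> triangles, which is exactly the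
  decrease of \<open>n\<^sup>2/8\<close> from \<open>n\<close> to \<open>n - 8\<close>; the exceptional values for \<open>4 \<le> n - 8 \<le> 7\<close> come from
  a third disjoint \<open>K\<^sub>4\<close>, and then counting edges suffices. If all \<open>K\<^sub>4\<close>s meet pairwise, they share a
  vertex, and Mantel is applied outside their union.\<close>

text \<open>Why two K4s at a time: deleting a single K4 can cost 4 + (n - 4) = n triangles by these
  estimates, but n^2/8 drops only by n - 2. For disjoint K4s K and K' with rest Z, each vertex of Z
  has at most one neighbour in K and one in K', which accounts for 8 + 2(n - 8) = 2n - 8 triangles.
  The obstacle is the up to four edges between K and K': each may enlarge a link of a vertex of K
  and add a triangle. Every such excess has to be paid for by a deficit in the link of a vertex of
  K'. The induction cannot pass through 4 to 7 vertices, because n^2/8 is smaller than the true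
  maximum there; hence 12 to 15 vertices need a separate argument when Z still contains a
  K4.\<close>

text \<open>Deleting vertices shrinks \<open>A\<close> and leaves the edge set \<open>F\<close>
  fixed, so hypotheses on \<open>F\<close> survive every induction.\<close>

definition edges_on :: "'a set set \<Rightarrow> 'a set \<Rightarrow> 'a set set" where
  "edges_on F A = {e \<in> F. e \<subseteq> A}"

definition nbrs :: "'a set set \<Rightarrow> 'a \<Rightarrow> 'a set \<Rightarrow> 'a set" where
  "nbrs F v A = {u \<in> A. {v, u} \<in> F}"

definition cross :: "'a set set \<Rightarrow> 'a set \<Rightarrow> 'a set \<Rightarrow> 'a set set" where
  "cross F A B = {e \<in> F. \<exists>a\<in>A. \<exists>b\<in>B. e = {a, b}}"

definition cliques :: "'a set set \<Rightarrow> nat \<Rightarrow> 'a set \<Rightarrow> 'a set set" where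
  "cliques F k A = {S. S \<subseteq> A \<and> card S = k \<and> (\<forall>x\<in>S. \<forall>y\<in>S. x \<noteq> y \<longrightarrow> {x, y} \<in> F)}"

lemma nbrs_iff [simp]: "u \<in> nbrs F v A \<longleftrightarrow> u \<in> A \<and> {v, u} \<in> F"
  by (simp add: nbrs_def)

lemma finite_edges_on [simp]: "finite A \<Longrightarrow> finite (edges_on F A)"
  by (rule finite_subset[of _ "Pow A"]) (auto simp: edges_on_def)

lemma finite_cliques [simp]: "finite A \<Longrightarrow> finite (cliques F k A)"
  by (rule finite_subset[of _ "Pow A"]) (auto simp: cliques_def)

lemma finite_nbrs [simp]: "finite A \<Longrightarrow> finite (nbrs F v A)"
  by (simp add: nbrs_def)

lemma cliques_mono: "A \<subseteq> B \<Longrightarrow> cliques F k A \<subseteq> cliques F k B"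
  by (auto simp: cliques_def)

lemma clique_adj: "S \<in> cliques F k A \<Longrightarrow> x \<in> S \<Longrightarrow> y \<in> S \<Longrightarrow> x \<noteq> y \<Longrightarrow> {x, y} \<in> F"
  by (auto simp: cliques_def)

lemma clique_card: "S \<in> cliques F k A \<Longrightarrow> card S = k"
  by (auto simp: cliques_def)

lemma clique_sub: "S \<in> cliques F k A \<Longrightarrow> S \<subseteq> A"
  by (auto simp: cliques_def)

section \<open>Edge counts between vertex sets, and Mantel's theorem\<close>

lemma card_cross_le:
  assumes "finite A" "finite B" and deg: "\<And>b. b \<in> B \<Longrightarrow> card (nbrs F b A) \<le> c"
  shows "finite (cross F A B)" "card (cross F A B) \<le> c * card B"
proof -
  let ?S = "SIGMA b:B. nbrs F b A"
  have sub: "cross F A B \<subseteq> (\<lambda>(b, a). {b, a}) ` ?S"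
    by (fastforce simp: cross_def insert_commute)
  have fin: "finite ?S" using assms by auto
  show "finite (cross F A B)" using sub fin finite_surj by blast
  have "card (cross F A B) \<le> card ?S" using sub fin surj_card_le by blast
  also have "\<dots> = (\<Sum>b\<in>B. card (nbrs F b A))" using assms by simp
  also have "\<dots> \<le> c * card B" using sum_bounded_above[of B "\<lambda>b. card (nbrs F b A)" c] deg
    by (simp add: mult.commute)
  finally show "card (cross F A B) \<le> c * card B" .
qed

lemma edges_on_Un:
  assumes "\<And>e. e \<in> F \<Longrightarrow> card e = 2"
  shows "edges_on F (A \<union> B) \<subseteq> edges_on F A \<union> edges_on F B \<union> cross F A B"
proof
  fix e assume e: "e \<in> edges_on F (A \<union> B)"
  then obtain x y where "e = {x, y}" using assms[of e] by (auto simp: edges_on_def card_2_iff)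
  with e show "e \<in> edges_on F A \<union> edges_on F B \<union> cross F A B"
    by (auto simp: edges_on_def cross_def insert_commute)
qed

lemma card_edges_on_Un:
  assumes "\<And>e. e \<in> F \<Longrightarrow> card e = 2" "finite A" "finite B"
    and deg: "\<And>b. b \<in> B \<Longrightarrow> card (nbrs F b A) \<le> c"
  shows "card (edges_on F (A \<union> B)) \<le> card (edges_on F A) + card (edges_on F B) + c * card B"
proof -
  have "card (edges_on F (A \<union> B)) \<le> card (edges_on F A \<union> edges_on F B \<union> cross F A B)"
    using edges_on_Un[of F A B] assms(1-3) card_cross_le(1)[OF assms(2,3) deg]
    by (intro card_mono) auto
  also have "\<dots> \<le> card (edges_on F A) + card (edges_on F B) + card (cross F A B)"
    by (meson add_le_mono card_Un_le le_trans order_refl)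
  finally show ?thesis using card_cross_le(2)[OF assms(2,3) deg] by linarith
qed

lemma card_le_one_if_unique:
  "(\<And>x y. x \<in> S \<Longrightarrow> y \<in> S \<Longrightarrow> x = y) \<Longrightarrow> card S \<le> 1"
  by (cases "finite S") (auto simp: card_le_Suc0_iff_eq)

lemma card_gt_one_ne:
  assumes "\<not> card S \<le> 1" shows "\<exists>x\<in>S. x \<noteq> c"
proof (rule ccontr)
  assume "\<not> ?thesis"
  then have "card S \<le> 1" by (intro card_le_one_if_unique) metis
  with assms show False by simp
qed

text \<open>Removing both ends of an edge loses at most \<open>card U - 1\<close> edges, since no
  vertex sees both ends, and this is exactly the decrease of (card U)^2 / 4.\<close>

lemma mantel:
  assumes "finite U" and "\<And>e. e \<in> H \<Longrightarrow> card e = 2"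
    and tf: "\<And>x y z. {x, y} \<in> H \<Longrightarrow> {y, z} \<in> H \<Longrightarrow> {x, z} \<in> H \<Longrightarrow> False"
  shows "4 * card (edges_on H U) \<le> (card U)\<^sup>2"
  using assms(1)
proof (induction "card U" arbitrary: U rule: less_induct)
  case less
  show ?case
  proof (cases "edges_on H U = {}")
    case True
    then show ?thesis by simp
  next
    case False
    then obtain e where e: "e \<in> H" "e \<subseteq> U" by (auto simp: edges_on_def)
    then obtain x y where xy: "e = {x, y}" "x \<noteq> y" using assms(2) by (metis card_2_iff)
    let ?W = "U - {x, y}"
    have U: "U = {x, y} \<union> ?W" using e xy by auto
    have c: "card U = card ?W + 2"
    proof -
      have "card {x, y} = 2" "{x, y} \<subseteq> U" using e xy by auto
      then show ?thesis using less.prems card_Diff_subset[of "{x, y}" U] card_mono[of U "{x, y}"] by simp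
    qed
    have IH: "4 * card (edges_on H ?W) \<le> (card ?W)\<^sup>2"
      by (rule less.hyps) (use c less.prems in auto)
    have deg: "card (nbrs H b {x, y}) \<le> 1" for b
      by (rule card_le_one_if_unique) (use tf[of x b y] e xy in \<open>auto simp: insert_commute\<close>)
    have "edges_on H {x, y} \<subseteq> {{x, y}}"
    proof
      fix f assume "f \<in> edges_on H {x, y}"
      then have "f \<subseteq> {x, y}" "card f = card {x, y}" using assms(2) xy by (auto simp: edges_on_def)
      then show "f \<in> {{x, y}}" by (metis card_subset_eq finite.emptyI finite.insertI singletonI)
    qed
    then have "card (edges_on H {x, y}) \<le> 1"
      using card_mono[of "{{x, y}}"] by simp
    moreover have "card (edges_on H U) \<le> card (edges_on H {x, y}) + card (edges_on H ?W) + 1 * card ?W"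
      using card_edges_on_Un[of H "{x, y}" ?W 1] assms(2) deg less.prems U by simp
    ultimately show ?thesis using IH c by (simp add: power2_eq_square algebra_simps)
  qed
qed

section \<open>Graphs without a path on four vertices\<close>

definition P4_free :: "'a set set \<Rightarrow> 'a set \<Rightarrow> bool" where
  "P4_free F A \<longleftrightarrow> (\<forall>p q r s. {p, q, r, s} \<subseteq> A \<longrightarrow> distinct [p, q, r, s] \<longrightarrow>
    {p, q} \<in> F \<longrightarrow> {q, r} \<in> F \<longrightarrow> {r, s} \<notin> F)"

lemma P4_freeD:
  "P4_free F A \<Longrightarrow> {p, q} \<in> F \<Longrightarrow> {q, r} \<in> F \<Longrightarrow> {r, s} \<in> F \<Longrightarrow>
    {p, q, r, s} \<subseteq> A \<Longrightarrow> distinct [p, q, r, s] \<Longrightarrow> False"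
  unfolding P4_free_def by blast

lemma P4_free_mono: "P4_free F A \<Longrightarrow> B \<subseteq> A \<Longrightarrow> P4_free F B"
  unfolding P4_free_def by (meson order_trans)

text \<open>The components are stars and triangles, so equality forces all of them to be triangles.\<close>

lemma edges_P4_free:
  assumes "finite A" and F2: "\<And>e. e \<in> F \<Longrightarrow> card e = 2"
    and nopath: "P4_free F A"
  shows "card (edges_on F A) \<le> card A \<and>
    (\<forall>x\<in>A. (\<forall>y\<in>A. \<forall>z\<in>A. {x, y} \<in> F \<longrightarrow> {x, z} \<in> F \<longrightarrow> {y, z} \<notin> F) \<longrightarrow>
      card (edges_on F A) < card A)"
  using assms(1) nopath
proof (induction "card A" arbitrary: A rule: less_induct)
  case less
  have irr: "{x, x} \<notin> F" for x using F2 by fastforce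
  show ?case
  proof (cases "\<exists>v\<in>A. card (nbrs F v A) \<le> 1")
    case True
    then obtain v where v: "v \<in> A" "card (nbrs F v A) \<le> 1" by auto
    let ?B = "A - {v}"
    have cA: "card A = Suc (card ?B)" using v less.prems(1) by (metis card.remove)
    have np: "P4_free F ?B" using less.prems(2) by (rule P4_free_mono) auto
    have "card ?B < card A" "finite ?B" using cA less.prems(1) by simp_all
    note hyp = less.hyps[OF this np]
    have IH: "card (edges_on F ?B) \<le> card ?B"
      "\<And>x. x \<in> ?B \<Longrightarrow> (\<forall>y\<in>?B. \<forall>z\<in>?B. {x, y} \<in> F \<longrightarrow> {x, z} \<in> F \<longrightarrow> {y, z} \<notin> F) \<Longrightarrow>
        card (edges_on F ?B) < card ?B"
      using hyp by blast+
    have vB: "nbrs F v ?B = nbrs F v A" using irr by auto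
    have "card (edges_on F (?B \<union> {v})) \<le> card (edges_on F ?B) + card (edges_on F {v}) + card (nbrs F v A) * card {v}"
      by (rule card_edges_on_Un) (use F2 less.prems vB in auto)
    moreover have "edges_on F {v} = {}" using F2[of "{}"] F2[of "{v}"] by (auto simp: edges_on_def subset_singleton_iff)
    moreover have "?B \<union> {v} = A" using v by auto
    ultimately have e: "card (edges_on F A) \<le> card (edges_on F ?B) + card (nbrs F v A)" by simp
    \<comment> \<open>A vertex \<open>v\<close> of degree at most one forces strictness: a neighbour
      \<open>w\<close> of \<open>v\<close> lies in no triangle of \<open>?B\<close>, since a
      triangle \<open>w\<close>, \<open>y\<close>, \<open>z\<close> would give the path
      \<open>v\<close>, \<open>w\<close>, \<open>y\<close>, \<open>z\<close>; so the strict
      induction hypothesis applies to \<open>?B\<close>.\<close>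
    have strict: "card (edges_on F A) < card A"
      if x: "x \<in> A" "\<forall>y\<in>A. \<forall>z\<in>A. {x, y} \<in> F \<longrightarrow> {x, z} \<in> F \<longrightarrow> {y, z} \<notin> F" for x
    proof (cases "nbrs F v A = {}")
      case True
      then show ?thesis using e IH(1) cA by simp
    next
      case False
      then obtain w where w: "w \<in> A" "{v, w} \<in> F" by auto
      then have wv: "w \<noteq> v" using irr by auto
      have "\<exists>x\<in>?B. \<forall>y\<in>?B. \<forall>z\<in>?B. {x, y} \<in> F \<longrightarrow> {x, z} \<in> F \<longrightarrow> {y, z} \<notin> F"
      proof (rule bexI[of _ w], intro ballI impI notI)
        fix y z assume *: "y \<in> ?B" "z \<in> ?B" "{w, y} \<in> F" "{w, z} \<in> F" "{y, z} \<in> F"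
        then have "y \<noteq> z" "w \<noteq> y" "w \<noteq> z" using irr by auto
        then show False
          by (intro P4_freeD[OF less.prems(2) w(2) *(3,5)]) (use * w v wv in auto)
      qed (use w wv in auto)
      then have "card (edges_on F ?B) < card ?B" using IH(2) by blast
      then show ?thesis using e v(2) cA by linarith
    qed
    show ?thesis using e IH(1) v(2) cA strict by auto
  next
    case False
    \<comment> \<open>Now all degrees are at least two. A second neighbour \<open>w\<close> of
      \<open>y\<close> other than \<open>z\<close> would give the path \<open>z\<close>,
      \<open>v\<close>, \<open>y\<close>, \<open>w\<close>, so every vertex lies in a
      triangle.\<close>
    have tri: "\<exists>y z. y \<in> A \<and> z \<in> A \<and> {v, y} \<in> F \<and> {v, z} \<in> F \<and> {y, z} \<in> F" if v: "v \<in> A" for v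
    proof -
      have "\<not> card (nbrs F v A) \<le> 1" using False v by auto
      then obtain y z where yz: "y \<in> A" "z \<in> A" "{v, y} \<in> F" "{v, z} \<in> F" "y \<noteq> z"
        using card_le_one_if_unique[of "nbrs F v A"] nbrs_iff by metis
      have "\<not> card (nbrs F y A) \<le> 1" using False yz by auto
      then obtain w where w: "w \<in> A" "{y, w} \<in> F" "w \<noteq> v"
        using card_gt_one_ne[of "nbrs F y A" v] nbrs_iff by metis
      have "w = z"
      proof (rule ccontr)
        assume "w \<noteq> z"
        moreover have "{z, v} \<in> F" using yz(4) by (simp add: insert_commute)
        moreover have "v \<noteq> y" "v \<noteq> z" "y \<noteq> w" using yz w irr by auto
        ultimately show False
          by (intro P4_freeD[OF less.prems(2) _ yz(3) w(2), of z]) (use yz w v in auto)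
      qed
      then show ?thesis using yz w by auto
    qed
    have "card (edges_on F A) \<le> card A"
    proof (cases "A = {}")
      case True
      have "edges_on F {} = {}" using F2[of "{}"] by (auto simp: edges_on_def)
      then show ?thesis using True by simp
    next
      case False
      then obtain v where v: "v \<in> A" by auto
      then obtain y z where yz: "y \<in> A" "z \<in> A" "{v, y} \<in> F" "{v, z} \<in> F" "{y, z} \<in> F"
        using tri by blast
      have d: "v \<noteq> y" "v \<noteq> z" "y \<noteq> z" using yz irr by auto
      let ?T = "{v, y, z}" and ?B = "A - {v, y, z}"
      have cT: "card ?T = 3" using d by simp
      have cA: "card A = card ?B + 3"
        using cT v yz less.prems(1) card_Diff_subset[of ?T A] card_mono[of A ?T] by auto
      have np: "P4_free F ?B" using less.prems(2) by (rule P4_free_mono) auto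
      have "card ?B < card A" "finite ?B" using cA less.prems(1) by simp_all
      then have IH: "card (edges_on F ?B) \<le> card ?B" using less.hyps[OF _ _ np] by blast
      \<comment> \<open>The triangle is a whole component: an edge entering it continues along two
        of its sides to a path on four vertices.\<close>
      have no: "{b, t} \<notin> F" if bt': "b \<in> ?B" "t \<in> ?T" for b t
      proof
        assume bt: "{b, t} \<in> F"
        obtain p q where pq: "{p, q} \<subseteq> ?T" "distinct [t, p, q]" "{t, p} \<in> F" "{p, q} \<in> F"
        proof -
          consider "t = v" | "t = y" | "t = z" using bt'(2) by auto
          then show thesis
          proof cases
            case 1 then show thesis using that[of y z] d yz(3-5) by simp
          next
            case 2 then show thesis using that[of z v] d yz(3-5) by (simp add: insert_commute)
          next
            case 3 then show thesis using that[of v y] d yz(3-5) by (simp add: insert_commute)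
          qed
        qed
        have "?T \<subseteq> A" using v yz by simp
        then have "{b, t, p, q} \<subseteq> A" using bt' pq(1) by blast
        moreover have "b \<noteq> t" "b \<noteq> p" "b \<noteq> q" using bt' pq(1) by blast+
        then have "distinct [b, t, p, q]" using pq(2) by simp
        ultimately show False using P4_freeD[OF less.prems(2) bt pq(3,4)] by blast
      qed
      have "nbrs F b ?T = {}" if "b \<in> ?B" for b using no[OF that] by (auto simp: nbrs_def)
      then have "card (edges_on F (?T \<union> ?B)) \<le> card (edges_on F ?T) + card (edges_on F ?B) + 0 * card ?B"
        by (intro card_edges_on_Un) (use F2 less.prems in auto)
      moreover have "?T \<union> ?B = A" using v yz by auto
      moreover have "edges_on F ?T \<subseteq> {{v, y}, {v, z}, {y, z}}"
      proof
        fix e assume "e \<in> edges_on F ?T"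
        moreover from this obtain p q where "e = {p, q}" "p \<noteq> q"
          using F2 by (metis (no_types, lifting) card_2_iff edges_on_def mem_Collect_eq)
        ultimately have "e = {p, q}" "p \<noteq> q" "p \<in> ?T" "q \<in> ?T" by (auto simp: edges_on_def)
        then show "e \<in> {{v, y}, {v, z}, {y, z}}" by auto
      qed
      then have "card (edges_on F ?T) \<le> 3"
        by (rule order_trans[OF card_mono, rotated]) (simp_all add: card_insert_if)
      ultimately show ?thesis using IH cA by simp
    qed
    then show ?thesis using tri by blast
  qed
qed

section \<open>Triangles, K4s and links in a graph without the suspension\<close>

lemma clique3_obtain:
  assumes "T \<in> cliques F 3 V" "a \<in> T"
  obtains x y where "T = {a, x, y}" "a \<noteq> x" "a \<noteq> y" "x \<noteq> y"
    "{a, x} \<in> F" "{a, y} \<in> F" "{x, y} \<in> F"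
proof -
  have "card (T - {a}) = 2" using clique_card[OF assms(1)] assms(2) by simp
  then obtain x y where xy: "T - {a} = {x, y}" "x \<noteq> y" by (auto simp: card_2_iff)
  then have T: "T = {a, x, y}" "a \<noteq> x" "a \<noteq> y" using assms(2) by auto
  then show thesis using that[OF T xy(2)] clique_adj[OF assms(1)] xy(2) by simp
qed

lemma clique3I:
  assumes "{x, y, z} \<subseteq> V" "x \<noteq> y" "x \<noteq> z" "y \<noteq> z" "{x, y} \<in> F" "{x, z} \<in> F" "{y, z} \<in> F"
  shows "{x, y, z} \<in> cliques F 3 V"
  using assms by (auto simp: cliques_def insert_commute)

lemma clique4I:
  assumes "{w, x, y, z} \<subseteq> V" "distinct [w, x, y, z]" "{w, x} \<in> F" "{w, y} \<in> F" "{w, z} \<in> F"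
    "{x, y} \<in> F" "{x, z} \<in> F" "{y, z} \<in> F"
  shows "{w, x, y, z} \<in> cliques F 4 V"
  using assms by (auto simp: cliques_def insert_commute)

locale susp_free =
  fixes F :: "'a set set"
  assumes card_edge: "e \<in> F \<Longrightarrow> card e = 2"
    and no_susp: "distinct [a, p, q, r, s] \<Longrightarrow> {a, p} \<in> F \<Longrightarrow> {a, q} \<in> F \<Longrightarrow> {a, r} \<in> F \<Longrightarrow>
      {a, s} \<in> F \<Longrightarrow> {p, q} \<in> F \<Longrightarrow> {q, r} \<in> F \<Longrightarrow> {r, s} \<in> F \<Longrightarrow> False"
begin

lemma irrefl: "{x, x} \<notin> F"
  using card_edge[of "{x, x}"] by auto

text \<open>If \<open>c\<close>, \<open>d\<close> are the other two vertices of \<open>K\<close>,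
  then \<open>v\<close>, \<open>y\<close>, \<open>c\<close>, \<open>d\<close> is a path in the link
  of \<open>x\<close>.\<close>

lemma K4_nbr_unique:
  assumes K: "K \<in> cliques F 4 V" and v: "v \<notin> K" and xy: "x \<in> K" "y \<in> K" "{v, x} \<in> F" "{v, y} \<in> F"
  shows "x = y"
proof (rule ccontr)
  assume ne: "x \<noteq> y"
  have "card (K - {x, y}) = 2" using clique_card[OF K] xy ne by (simp add: card_Diff_subset)
  then obtain c d where cd: "K - {x, y} = {c, d}" "c \<noteq> d" by (auto simp: card_2_iff)
  then have *: "c \<in> K" "d \<in> K" "c \<noteq> x" "d \<noteq> x" "c \<noteq> y" "d \<noteq> y" by auto
  then have "v \<noteq> c" "v \<noteq> d" "v \<noteq> x" "v \<noteq> y" using v xy by auto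
  then show False
    using no_susp[of x v y c d] clique_adj[OF K] xy ne cd(2) * by (auto simp: insert_commute)
qed

lemma card_nbrs_K4:
  assumes "K \<in> cliques F 4 V" "v \<notin> K"
  shows "card (nbrs F v K) \<le> 1"
  using K4_nbr_unique[OF assms] by (intro card_le_one_if_unique) auto

lemma clique3_subset_K4:
  assumes T: "T \<in> cliques F 3 V" and K: "K \<in> cliques F 4 W"
    and xy: "x \<in> T" "y \<in> T" "x \<in> K" "y \<in> K" "x \<noteq> y"
  shows "T \<subseteq> K"
proof
  fix z assume z: "z \<in> T"
  show "z \<in> K"
  proof (rule ccontr)
    assume "z \<notin> K"
    then show False
      using K4_nbr_unique[OF K, of z x y] clique_adj[OF T] z xy by metis
  qed
qed

text \<open>With two common vertices, every vertex of \<open>L\<close> outside \<open>K\<close>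
  would have two neighbours in \<open>K\<close>. Hence distinct K4s are edge-disjoint.\<close>

lemma K4_inter:
  assumes K: "K \<in> cliques F 4 V" and L: "L \<in> cliques F 4 W" and "K \<noteq> L"
    and xy: "x \<in> K" "y \<in> K" "x \<in> L" "y \<in> L"
  shows "x = y"
proof (rule ccontr)
  assume ne: "x \<noteq> y"
  have "L \<subseteq> K"
  proof
    fix z assume z: "z \<in> L"
    show "z \<in> K"
    proof (rule ccontr)
      assume "z \<notin> K"
      then show False
        using K4_nbr_unique[OF K, of z x y] clique_adj[OF L] z xy ne by metis
    qed
  qed
  moreover have "finite K" using clique_card[OF K] by (intro card_ge_0_finite) simp
  ultimately show False using clique_card[OF K] clique_card[OF L] \<open>K \<noteq> L\<close> card_subset_eq by metis
qed

text \<open>Edges of the link of \<open>a\<close> correspond to triangles through \<open>a\<close>,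
  so the first part bounds these by the degree. The second part is the source of the deficits needed
  when two K4s are deleted.\<close>

lemma link_edges:
  assumes "finite V"
  shows "card (edges_on F (nbrs F a V)) \<le> card (nbrs F a V)"
    and "x \<in> nbrs F a V \<Longrightarrow> (\<And>y z. y \<in> nbrs F a V \<Longrightarrow> z \<in> nbrs F a V \<Longrightarrow>
      {x, y} \<in> F \<Longrightarrow> {x, z} \<in> F \<Longrightarrow> {y, z} \<in> F \<Longrightarrow> False) \<Longrightarrow>
      card (edges_on F (nbrs F a V)) < card (nbrs F a V)"
proof -
  have "P4_free F (nbrs F a V)"
    unfolding P4_free_def
  proof (intro allI impI notI)
    fix p q r s assume *: "{p, q, r, s} \<subseteq> nbrs F a V" "distinct [p, q, r, s]"
      "{p, q} \<in> F" "{q, r} \<in> F" "{r, s} \<in> F"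
    then have **: "{a, p} \<in> F" "{a, q} \<in> F" "{a, r} \<in> F" "{a, s} \<in> F" by simp_all
    then have "a \<noteq> p" "a \<noteq> q" "a \<noteq> r" "a \<noteq> s" using irrefl by auto
    then have "distinct [a, p, q, r, s]" using *(2) by simp
    from no_susp[OF this ** *(3-5)] show False .
  qed
  from edges_P4_free[OF _ card_edge this] assms
  have *: "card (edges_on F (nbrs F a V)) \<le> card (nbrs F a V) \<and>
    (\<forall>x\<in>nbrs F a V. (\<forall>y\<in>nbrs F a V. \<forall>z\<in>nbrs F a V. {x, y} \<in> F \<longrightarrow> {x, z} \<in> F \<longrightarrow> {y, z} \<notin> F) \<longrightarrow>
      card (edges_on F (nbrs F a V)) < card (nbrs F a V))"
    by auto
  then show "card (edges_on F (nbrs F a V)) \<le> card (nbrs F a V)" ..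
  show "card (edges_on F (nbrs F a V)) < card (nbrs F a V)"
    if "x \<in> nbrs F a V" "\<And>y z. y \<in> nbrs F a V \<Longrightarrow> z \<in> nbrs F a V \<Longrightarrow>
      {x, y} \<in> F \<Longrightarrow> {x, z} \<in> F \<Longrightarrow> {y, z} \<in> F \<Longrightarrow> False"
    using * that by meson
qed

lemma card_cliques3_K4:
  assumes "K \<in> cliques F 4 V"
  shows "card (cliques F 3 K) \<le> 4"
proof -
  have K: "finite K" "card K = 4" using clique_card[OF assms] by (auto intro: card_ge_0_finite)
  have "card {S. S \<subseteq> K \<and> card S = 3} = 4"
    using n_subsets[OF K(1), of 3] K(2) by (simp add: numeral_eq_Suc)
  moreover have "card (cliques F 3 K) \<le> card {S. S \<subseteq> K \<and> card S = 3}"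
    using K(1) by (intro card_mono) (auto simp: cliques_def)
  ultimately show ?thesis by simp
qed

section \<open>Deleting one K4, then two disjoint ones\<close>

text \<open>A triangle that meets \<open>K\<close> without lying in it has exactly one vertex
  \<open>a\<close> in \<open>K\<close>; its opposite side is an edge of the link of \<open>a\<close>
  outside \<open>K\<close>.\<close>

lemma remove_K4:
  assumes V: "finite V" and K: "K \<in> cliques F 4 V"
  shows "card (cliques F 3 V) \<le>
    4 + (\<Sum>a\<in>K. card (edges_on F (nbrs F a (V - K)))) + card (cliques F 3 (V - K))"
proof -
  let ?I = "\<lambda>a. insert a ` edges_on F (nbrs F a (V - K))"
  have finK: "finite K" using clique_sub[OF K] V finite_subset by blast
  have "cliques F 3 V \<subseteq> cliques F 3 K \<union> (\<Union>a\<in>K. ?I a) \<union> cliques F 3 (V - K)"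
  proof
    fix T assume T: "T \<in> cliques F 3 V"
    show "T \<in> cliques F 3 K \<union> (\<Union>a\<in>K. ?I a) \<union> cliques F 3 (V - K)"
    proof (cases "T \<inter> K = {} \<or> T \<subseteq> K")
      case True
      then show ?thesis using T by (auto simp: cliques_def)
    next
      case False
      then obtain a z where az: "a \<in> T" "a \<in> K" "z \<in> T" "z \<notin> K" by auto
      obtain x y where xy: "T = {a, x, y}" "{a, x} \<in> F" "{a, y} \<in> F" "{x, y} \<in> F" "a \<noteq> x" "a \<noteq> y"
        using clique3_obtain[OF T az(1)] by metis
      have "x \<notin> K" "y \<notin> K"
        using clique3_subset_K4[OF T K, of a] az xy by blast+
      then have "{x, y} \<in> edges_on F (nbrs F a (V - K))"
        using xy clique_sub[OF T] by (auto simp: edges_on_def)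
      then show ?thesis using xy(1) az(2) by blast
    qed
  qed
  then have "card (cliques F 3 V) \<le> card (cliques F 3 K \<union> (\<Union>a\<in>K. ?I a) \<union> cliques F 3 (V - K))"
    using V finK by (intro card_mono) auto
  also have "\<dots> \<le> card (cliques F 3 K) + card (\<Union>a\<in>K. ?I a) + card (cliques F 3 (V - K))"
    by (meson add_le_mono card_Un_le le_trans order_refl)
  also have "card (\<Union>a\<in>K. ?I a) \<le> (\<Sum>a\<in>K. card (?I a))"
    using finK by (rule card_UN_le)
  also have "(\<Sum>a\<in>K. card (?I a)) \<le> (\<Sum>a\<in>K. card (edges_on F (nbrs F a (V - K))))"
    using V by (intro sum_mono card_image_le) simp
  finally show ?thesis using card_cliques3_K4[OF K] by simp
qed

lemma sum_card_nbrs_K4: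
  assumes "finite Z" "K \<in> cliques F 4 V" "K \<inter> Z = {}"
  shows "(\<Sum>a\<in>K. card (nbrs F a Z)) \<le> card Z"
proof -
  have finK: "finite K" using clique_card[OF assms(2)] by (intro card_ge_0_finite) simp
  have "(\<Sum>a\<in>K. card (nbrs F a Z)) = card (\<Union>a\<in>K. nbrs F a Z)"
  proof (rule card_UN_disjoint[symmetric])
    show "\<forall>a\<in>K. \<forall>b\<in>K. a \<noteq> b \<longrightarrow> nbrs F a Z \<inter> nbrs F b Z = {}"
      using K4_nbr_unique[OF assms(2)] assms(3) by (fastforce simp: insert_commute)
  qed (use assms finK in auto)
  also have "\<dots> \<le> card Z" using assms(1) by (intro card_mono) auto
  finally show ?thesis .
qed

text \<open>If the link of \<open>a \<in> K\<close> spans more edges than \<open>a\<close> has neighbours outside \<open>K \<union> K'\<close>, then it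
  consists of triangles, one of which passes through the neighbour \<open>x \<in> K'\<close> of \<open>a\<close>; in the link of \<open>x\<close>
  this triangle leaves behind a single edge, which is a star.\<close>

lemma surplus_compensated:
  assumes V: "finite V" and K: "K \<in> cliques F 4 V" and K': "K' \<in> cliques F 4 (V - K)" and a: "a \<in> K"
    and surplus: "card (nbrs F a (V - K - K')) < card (edges_on F (nbrs F a (V - K)))"
  shows "\<exists>x\<in>K'. {a, x} \<in> F \<and> card (edges_on F (nbrs F x (V - K - K'))) < card (nbrs F x (V - K - K'))
    \<and> card (edges_on F (nbrs F a (V - K))) \<le> Suc (card (nbrs F a (V - K - K')))"
proof -
  let ?Z = "V - K - K'"
  have aK': "a \<notin> K'" using clique_sub[OF K'] a by auto
  have split: "nbrs F a (V - K) = nbrs F a ?Z \<union> nbrs F a K'"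
    using clique_sub[OF K'] by auto
  have le: "card (nbrs F a (V - K)) \<le> card (nbrs F a ?Z) + card (nbrs F a K')"
    unfolding split by (rule card_Un_le)
  have le1: "card (nbrs F a K') \<le> 1" by (rule card_nbrs_K4[OF K' aK'])
  have el: "card (edges_on F (nbrs F a (V - K))) \<le> card (nbrs F a (V - K))"
    using V by (intro link_edges) simp
  have "nbrs F a K' \<noteq> {}" using le el surplus by auto
  then obtain x where x: "x \<in> K'" "{a, x} \<in> F" by auto
  then have xA: "x \<in> nbrs F a (V - K)" using clique_sub[OF K'] by auto
  \<comment> \<open>\<open>a\<close> has at most one neighbour in \<open>K'\<close>, so a surplus
    means that the link has at least as many edges as vertices; then each of its vertices, in
    particular \<open>x\<close>, lies in a triangle.\<close>
  have "\<not> card (edges_on F (nbrs F a (V - K))) < card (nbrs F a (V - K))"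
    using le le1 surplus by linarith
  then obtain y z where yz: "y \<in> nbrs F a (V - K)" "z \<in> nbrs F a (V - K)"
    "{x, y} \<in> F" "{x, z} \<in> F" "{y, z} \<in> F"
    using link_edges(2)[OF _ xA] V by (metis finite_Diff)
  have d: "x \<noteq> y" "x \<noteq> z" "y \<noteq> z" "a \<noteq> x" "a \<noteq> y" "a \<noteq> z" using yz x irrefl by auto
  have ynz: "y \<notin> K'" "z \<notin> K'"
    using K4_nbr_unique[OF K' aK' x(1)] x(2) yz d by auto
  let ?L = "{a, x, y, z}"
  have L: "?L \<in> cliques F 4 V"
    by (rule clique4I) (use d yz x a clique_sub[OF K] clique_sub[OF K'] in auto)
  have "card (edges_on F (nbrs F x ?Z)) < card (nbrs F x ?Z)"
  proof (rule link_edges(2)[of _ y])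
    show "y \<in> nbrs F x ?Z" using yz ynz by simp
    fix u w assume uw: "u \<in> nbrs F x ?Z" "w \<in> nbrs F x ?Z" "{y, u} \<in> F" "{y, w} \<in> F" "{u, w} \<in> F"
    \<comment> \<open>\<open>t\<close> is adjacent to both \<open>x\<close> and \<open>y\<close> of
      the K4 \<open>?L\<close>, so it belongs to \<open>?L\<close>; \<open>a\<close> and
      \<open>x\<close> are outside \<open>?Z\<close>, which leaves \<open>z\<close>. Thus
      \<open>y\<close> lies in no triangle of this link.\<close>
    have *: "t = z" if t: "t \<in> nbrs F x ?Z" "{y, t} \<in> F" for t
    proof -
      have "t \<in> ?L"
      proof (rule ccontr)
        assume "t \<notin> ?L"
        then show False using K4_nbr_unique[OF L, of t x y] t d by (auto simp: insert_commute)
      qed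
      moreover have "t \<noteq> a" "t \<noteq> x" "t \<noteq> y" using t a x(1) irrefl by auto
      ultimately show ?thesis by auto
    qed
    show False using *[OF uw(1,3)] *[OF uw(2,4)] uw(5) irrefl by auto
  qed (use V in simp)
  then show ?thesis using x le le1 el by (intro bexI[of _ x]) auto
qed

text \<open>\<open>?S\<close> collects the vertices of \<open>K\<close> with surplus, always exactly
  one, and \<open>?S'\<close> those of \<open>K'\<close> with a deficit. The partner map
  \<open>f\<close> is injective because a vertex of \<open>K'\<close> has at most one neighbour in
  \<open>K\<close>. So the surpluses are paid for, and both sums of link sizes together stay within
  \<open>2 * card ?Z\<close>.\<close>

lemma remove_two_K4:
  assumes V: "finite V" and K: "K \<in> cliques F 4 V" and K': "K' \<in> cliques F 4 (V - K)"
  shows "card (cliques F 3 V) \<le> 8 + 2 * card (V - K - K') + card (cliques F 3 (V - K - K'))"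
proof -
  let ?Z = "V - K - K'"
  let ?g = "\<lambda>a. card (edges_on F (nbrs F a (V - K)))" and ?h = "\<lambda>x. card (edges_on F (nbrs F x ?Z))"
  let ?n = "\<lambda>v. card (nbrs F v ?Z)"
  let ?S = "{a \<in> K. ?n a < ?g a}" and ?S' = "{x \<in> K'. ?h x < ?n x}"
  have fin: "finite K" "finite K'" using V clique_sub[OF K] clique_sub[OF K'] finite_subset by blast+
  obtain f where f: "\<And>a. a \<in> ?S \<Longrightarrow> f a \<in> ?S' \<and> {a, f a} \<in> F \<and> ?g a \<le> Suc (?n a)"
    using surplus_compensated[OF V K K'] by (simp add: Bex_def) metis
  have "inj_on f ?S"
  proof (rule inj_onI)
    fix a b assume ab: "a \<in> ?S" "b \<in> ?S" "f a = f b"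
    have "f a \<notin> K" using f[OF ab(1)] clique_sub[OF K'] by auto
    then show "a = b"
      using K4_nbr_unique[OF K, of "f a" a b] ab f[OF ab(1)] f[OF ab(2)] by (simp add: insert_commute)
  qed
  then have SS': "card ?S \<le> card ?S'" using f fin by (intro card_inj_on_le[of f]) auto
  have "(\<Sum>a\<in>K. ?g a) \<le> (\<Sum>a\<in>K. ?n a + (if a \<in> ?S then 1 else 0))"
    using f by (intro sum_mono) (force split: if_splits)
  also have "\<dots> = (\<Sum>a\<in>K. ?n a) + card ?S"
    using fin by (simp add: sum.distrib sum.If_cases Int_def)
  finally have g: "(\<Sum>a\<in>K. ?g a) \<le> card ?Z + card ?S"
    using sum_card_nbrs_K4[of ?Z K V] V K by fastforce
  have "(\<Sum>x\<in>K'. ?h x) + card ?S' = (\<Sum>x\<in>K'. ?h x + (if x \<in> ?S' then 1 else 0))"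
    using fin by (simp add: sum.distrib sum.If_cases Int_def)
  also have "\<dots> \<le> (\<Sum>x\<in>K'. ?n x)"
  proof (rule sum_mono)
    fix x
    have "?h x \<le> ?n x" using V by (intro link_edges) simp
    then show "?h x + (if x \<in> ?S' then 1 else 0) \<le> ?n x" by auto
  qed
  also have "\<dots> \<le> card ?Z" using sum_card_nbrs_K4[of ?Z K' "V - K"] V K' by fastforce
  finally have h: "(\<Sum>x\<in>K'. ?h x) + card ?S' \<le> card ?Z" .
  show ?thesis using remove_K4[OF V K] remove_K4[OF _ K'] V g h SS' by simp
qed

section \<open>Triangles that lie in no K4\<close>

definition loose :: "'a set \<Rightarrow> 'a set set" where
  "loose V = {T \<in> cliques F 3 V. \<forall>K\<in>cliques F 4 V. \<not> T \<subseteq> K}"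

lemma finite_loose [simp]: "finite V \<Longrightarrow> finite (loose V)"
  by (simp add: loose_def)

definition private_edge :: "'a set \<Rightarrow> 'a set \<Rightarrow> 'a set \<Rightarrow> bool" where
  "private_edge V T e \<longleftrightarrow> (\<forall>T'\<in>cliques F 3 V. e \<subseteq> T' \<longrightarrow> T' = T)"

text \<open>Otherwise both sides at \<open>z\<close> lie in further triangles, with third vertices
  \<open>v\<close> and \<open>w\<close>. If \<open>v\<close> and \<open>w\<close> differ, then
  \<open>v\<close>, \<open>x\<close>, \<open>y\<close>, \<open>w\<close> is a path in the link of
  \<open>z\<close>; if they agree, \<open>T\<close> lies in a K4.\<close>

lemma private_edge_at:
  assumes T: "T \<in> loose V" "T = {z, x, y}" "distinct [z, x, y]"
  shows "private_edge V T {z, x} \<or> private_edge V T {z, y}"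
proof (rule ccontr)
  assume "\<not> ?thesis"
  then obtain T1 T2 where T1: "T1 \<in> cliques F 3 V" "z \<in> T1" "x \<in> T1" "T1 \<noteq> T"
    and T2: "T2 \<in> cliques F 3 V" "z \<in> T2" "y \<in> T2" "T2 \<noteq> T"
    unfolding private_edge_def by auto
  have T3: "T \<in> cliques F 3 V" using T by (simp add: loose_def)
  have out: "\<exists>w\<in>T'. w \<notin> T" if "T' \<in> cliques F 3 V" "T' \<noteq> T" for T'
  proof (rule ccontr)
    assume "\<not> ?thesis"
    then have "T' \<subseteq> T" "finite T" using T by auto
    then show False using clique_card[OF that(1)] clique_card[OF T3] that(2) card_subset_eq by metis
  qed
  obtain v w where v: "v \<in> T1" "v \<notin> T" and w: "w \<in> T2" "w \<notin> T"
    using out[OF T1(1,4)] out[OF T2(1,4)] by auto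
  have ne: "v \<noteq> x" "v \<noteq> y" "v \<noteq> z" "w \<noteq> x" "w \<noteq> y" "w \<noteq> z" using v w T by auto
  have e: "{z, v} \<in> F" "{z, x} \<in> F" "{z, y} \<in> F" "{z, w} \<in> F" "{v, x} \<in> F" "{x, y} \<in> F" "{y, w} \<in> F"
    using clique_adj[OF T1(1)] clique_adj[OF T2(1)] clique_adj[OF T3] T1 T2 v w T ne by auto
  show False
  proof (cases "v = w")
    case True
    have "{v, x, y, z} \<in> cliques F 4 V"
      by (rule clique4I) (use e ne T True v(1) clique_sub[OF T1(1)] clique_sub[OF T3] in \<open>auto simp: insert_commute\<close>)
    moreover have "T \<subseteq> {v, x, y, z}" using T by auto
    ultimately show False using T(1) by (auto simp: loose_def)
  next
    case False
    then show False using no_susp[of z v x y w] ne T(3) e by auto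
  qed
qed

text \<open>Two sides of a triangle always share a vertex, so at most one side is not private; the
  vertex opposite to it is the apex.\<close>

lemma apex_exists:
  assumes "T \<in> loose V"
  shows "\<exists>z\<in>T. \<forall>x\<in>T - {z}. private_edge V T {z, x}"
proof -
  have "card T = 3" using assms by (simp add: loose_def cliques_def)
  then obtain x y z where T: "T = {x, y, z}" "x \<noteq> y" "y \<noteq> z" "x \<noteq> z" by (auto simp: card_3_iff)
  have "private_edge V T {x, y} \<or> private_edge V T {x, z}"
    "private_edge V T {y, x} \<or> private_edge V T {y, z}"
    "private_edge V T {z, x} \<or> private_edge V T {z, y}"
    by (rule private_edge_at[OF assms]; use T in auto)+
  then have "private_edge V T {x, y} \<and> private_edge V T {x, z} \<or>
    private_edge V T {y, x} \<and> private_edge V T {y, z} \<or>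
    private_edge V T {z, x} \<and> private_edge V T {z, y}"
    by (auto simp: insert_commute)
  then show ?thesis using T by auto
qed

text \<open>The two edges kept for each \<open>T\<close> are private, so different \<open>T\<close>
  contribute disjoint pairs. A triangle in \<open>H\<close> would have to be the owner of all three
  of its sides, and its apex would lie on all of them. A kept edge inside a K4 would pull its loose
  triangle into that K4.\<close>

lemma triangle_free_subgraph:
  assumes V: "finite V"
  obtains H where "H \<subseteq> edges_on F V" "card H = 2 * card (loose V)"
    "\<And>x y z. {x, y} \<in> H \<Longrightarrow> {y, z} \<in> H \<Longrightarrow> {x, z} \<in> H \<Longrightarrow> False"
    "\<And>e K. e \<in> H \<Longrightarrow> K \<in> cliques F 4 V \<Longrightarrow> \<not> e \<subseteq> K"
proof -
  obtain c where c: "\<And>T. T \<in> loose V \<Longrightarrow> c T \<in> T \<and> (\<forall>x\<in>T - {c T}. private_edge V T {c T, x})"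
    using bchoice[of "loose V" "\<lambda>T z. z \<in> T \<and> (\<forall>x\<in>T - {z}. private_edge V T {z, x})"]
      apex_exists[of _ V] by blast
  define h where "h T = (\<lambda>x. {c T, x}) ` (T - {c T})" for T
  define H where "H = (\<Union>T\<in>loose V. h T)"
  have T3: "T \<in> cliques F 3 V" if "T \<in> loose V" for T using that by (simp add: loose_def)
  have sub: "e \<subseteq> T" "e \<in> F" "c T \<in> e" if "T \<in> loose V" "e \<in> h T" for T e
    using that c[OF that(1)] clique_adj[OF T3[OF that(1)]] by (auto simp: h_def)
  have priv: "T' = T" if "T \<in> loose V" "e \<in> h T" "T' \<in> cliques F 3 V" "e \<subseteq> T'" for T T' e
    using that c[OF that(1)] by (auto simp: h_def private_edge_def)
  have card_h: "card (h T) = 2" if T: "T \<in> loose V" for T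
  proof -
    have "inj_on (\<lambda>x. {c T, x}) (T - {c T})" by (rule inj_onI) (auto simp: doubleton_eq_iff)
    then show ?thesis using clique_card[OF T3[OF T]] c[OF T] by (simp add: h_def card_image)
  qed
  show thesis
  proof (rule that[of H])
    show "H \<subseteq> edges_on F V"
      using sub clique_sub[OF T3] by (fastforce simp: H_def edges_on_def)
    have "card H = (\<Sum>T\<in>loose V. card (h T))"
      unfolding H_def
    proof (rule card_UN_disjoint)
      show "\<forall>T\<in>loose V. finite (h T)" using card_h by (auto intro: card_ge_0_finite)
      show "\<forall>T\<in>loose V. \<forall>T'\<in>loose V. T \<noteq> T' \<longrightarrow> h T \<inter> h T' = {}"
        using priv sub T3 by (metis disjoint_iff)
    qed (use V in simp)
    then show "card H = 2 * card (loose V)" using card_h by simp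
    show False if xyz: "{x, y} \<in> H" "{y, z} \<in> H" "{x, z} \<in> H" for x y z
    proof -
      have F: "{x, y} \<in> F" "{y, z} \<in> F" "{x, z} \<in> F" "{x, y} \<subseteq> V" "{y, z} \<subseteq> V"
        using xyz \<open>H \<subseteq> edges_on F V\<close> by (auto simp: edges_on_def)
      then have ne: "x \<noteq> y" "y \<noteq> z" "x \<noteq> z" using irrefl by auto
      let ?T = "{x, y, z}"
      have T: "?T \<in> cliques F 3 V" by (rule clique3I) (use F ne in auto)
      have "e \<in> h ?T \<and> ?T \<in> loose V" if "e \<in> H" "e \<subseteq> ?T" for e
        using that priv[OF _ _ T] by (auto simp: H_def)
      then have "{x, y} \<in> h ?T" "{y, z} \<in> h ?T" "{x, z} \<in> h ?T" "?T \<in> loose V"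
        using xyz by auto
      then have "c ?T \<in> {x, y}" "c ?T \<in> {y, z}" "c ?T \<in> {x, z}" using sub(3) by blast+
      then show False using ne by auto
    qed
    show "\<not> e \<subseteq> K" if "e \<in> H" "K \<in> cliques F 4 V" for e K
    proof
      assume eK: "e \<subseteq> K"
      obtain T where T: "T \<in> loose V" "e \<in> h T" using \<open>e \<in> H\<close> by (auto simp: H_def)
      have "card e = 2" using sub(2)[OF T] card_edge by simp
      then obtain x y where "e = {x, y}" "x \<noteq> y" by (auto simp: card_2_iff)
      then have "T \<subseteq> K" using clique3_subset_K4[OF T3[OF T(1)] that(2), of x y] sub(1)[OF T] eK by simp
      then show False using T(1) that(2) by (auto simp: loose_def)
    qed
  qed
qed

lemma card_cliques3_le:
  assumes V: "finite V"
  shows "card (cliques F 3 V) \<le> 4 * card (cliques F 4 V) + card (loose V)"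
proof -
  have "cliques F 3 V \<subseteq> (\<Union>K\<in>cliques F 4 V. cliques F 3 K) \<union> loose V"
    by (auto simp: loose_def cliques_def)
  moreover have "finite K" if "K \<in> cliques F 4 V" for K
    using clique_sub[OF that] V finite_subset by blast
  ultimately have "card (cliques F 3 V) \<le> card ((\<Union>K\<in>cliques F 4 V. cliques F 3 K) \<union> loose V)"
    using V by (intro card_mono) auto
  also have "\<dots> \<le> card (\<Union>K\<in>cliques F 4 V. cliques F 3 K) + card (loose V)" by (rule card_Un_le)
  also have "card (\<Union>K\<in>cliques F 4 V. cliques F 3 K) \<le> (\<Sum>K\<in>cliques F 4 V. card (cliques F 3 K))"
    using V by (intro card_UN_le) simp
  also have "\<dots> \<le> card (cliques F 4 V) * 4"
    using sum_bounded_above[of "cliques F 4 V" "\<lambda>K. card (cliques F 3 K)" 4] card_cliques3_K4 by auto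
  finally show ?thesis by simp
qed

lemma bound_without_K4:
  assumes V: "finite V" and no: "cliques F 4 V = {}"
  shows "8 * card (cliques F 3 V) \<le> (card V)\<^sup>2"
proof -
  obtain H where H: "H \<subseteq> edges_on F V" "card H = 2 * card (loose V)"
    "\<And>x y z. {x, y} \<in> H \<Longrightarrow> {y, z} \<in> H \<Longrightarrow> {x, z} \<in> H \<Longrightarrow> False"
    using triangle_free_subgraph[OF V] by metis
  have "edges_on H V = H" using H(1) by (auto simp: edges_on_def)
  moreover have "card e = 2" if "e \<in> H" for e using that H(1) card_edge by (auto simp: edges_on_def)
  ultimately have "4 * card H \<le> (card V)\<^sup>2" using mantel[OF V, of H] H(3) by metis
  then show ?thesis using card_cliques3_le[OF V] no H(2) by simp
qed

section \<open>Pairwise intersecting K4s\<close>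

text \<open>Let \<open>K\<close> and \<open>L\<close> meet in \<open>a\<close>. A clique
  \<open>M\<close> avoiding \<open>a\<close> meets \<open>K\<close> in \<open>b\<close> and
  \<open>L\<close> in some \<open>x\<close> outside \<open>K\<close>, and \<open>x\<close> is
  adjacent to both \<open>a\<close> and \<open>b\<close>.\<close>

lemma concurrent:
  assumes ne: "cliques F 4 V \<noteq> {}"
    and meet: "\<And>K L. K \<in> cliques F 4 V \<Longrightarrow> L \<in> cliques F 4 V \<Longrightarrow> K \<inter> L \<noteq> {}"
  shows "\<exists>a. \<forall>K\<in>cliques F 4 V. a \<in> K"
proof -
  obtain K where K: "K \<in> cliques F 4 V" using ne by auto
  show ?thesis
  proof (cases "cliques F 4 V = {K}")
    case True
    then show ?thesis using meet[OF K K] by auto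
  next
    case False
    then obtain L where L: "L \<in> cliques F 4 V" "K \<noteq> L" using K by auto
    obtain a where a: "a \<in> K" "a \<in> L" using meet[OF K L(1)] by auto
    have "a \<in> M" if M: "M \<in> cliques F 4 V" for M
    proof (rule ccontr)
      assume aM: "a \<notin> M"
      obtain b x where b: "b \<in> K" "b \<in> M" and x: "x \<in> L" "x \<in> M"
        using meet[OF K M] meet[OF L(1) M] by auto
      have ne: "b \<noteq> a" "x \<noteq> a" using aM b x by auto
      have xK: "x \<notin> K" using K4_inter[OF K L(1) L(2), of x a] x a ne by auto
      then have "x \<noteq> b" using b by auto
      then have "{x, b} \<in> F" "{x, a} \<in> F"
        using clique_adj[OF M x(2) b(2)] clique_adj[OF L(1) x(1) a(2)] ne by auto
      then show False using K4_nbr_unique[OF K xK b(1) a(1)] ne by simp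
    qed
    then show ?thesis by auto
  qed
qed

text \<open>Here \<open>m\<close> counts the K4s, \<open>u\<close> the vertices outside their union
  \<open>W\<close>, and \<open>s\<close> the loose triangles. The graph \<open>H\<close> with
  \<open>2 * s\<close> edges has none inside \<open>W\<close>, at most \<open>m\<close> from each
  outside vertex to \<open>W\<close>, and at most u^2/4 outside by Mantel. If
  \<open>u \<le> 1\<close>, a loose triangle would have two vertices in \<open>W\<close> and so lie
  in a K4.\<close>

lemma bound_meeting_K4s:
  assumes V: "finite V" and ne: "cliques F 4 V \<noteq> {}"
    and meet: "\<And>K L. K \<in> cliques F 4 V \<Longrightarrow> L \<in> cliques F 4 V \<Longrightarrow> K \<inter> L \<noteq> {}"
  shows "\<exists>m u s. m \<ge> 1 \<and> card V = 3 * m + 1 + u \<and> card (cliques F 3 V) \<le> 4 * m + s \<and>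
    8 * s \<le> 4 * m * u + u\<^sup>2 \<and> (u \<le> 1 \<longrightarrow> s = 0)"
proof -
  let ?C = "cliques F 4 V"
  obtain a where a: "\<And>K. K \<in> ?C \<Longrightarrow> a \<in> K" using concurrent[OF ne meet] by blast
  define W where "W = \<Union>?C"
  define U where "U = V - W"
  have finC: "finite ?C" using V by simp
  have finK: "finite K" if "K \<in> ?C" for K using clique_sub[OF that] V finite_subset by blast
  have WV: "W \<subseteq> V" using clique_sub by (fastforce simp: W_def)
  then have fin: "finite W" "finite U" using V finite_subset by (auto simp: U_def)
  have VWU: "V = W \<union> U" using WV by (auto simp: U_def)
  have "W = insert a (\<Union>K\<in>?C. K - {a})" using a ne by (auto simp: W_def)
  then have "card W = card (insert a (\<Union>K\<in>?C. K - {a}))" by simp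
  also have "\<dots> = Suc (card (\<Union>K\<in>?C. K - {a}))"
    using finC finK by (intro card_insert_disjoint) auto
  also have "card (\<Union>K\<in>?C. K - {a}) = (\<Sum>K\<in>?C. card (K - {a}))"
  proof (rule card_UN_disjoint[OF finC])
    show "\<forall>K\<in>?C. finite (K - {a})" using finK by auto
    show "\<forall>K\<in>?C. \<forall>L\<in>?C. K \<noteq> L \<longrightarrow> (K - {a}) \<inter> (L - {a}) = {}"
      using K4_inter a by blast
  qed
  also have "(\<Sum>K\<in>?C. card (K - {a})) = (\<Sum>K\<in>?C. 3)"
    using a clique_card[of _ F 4 V] by (intro sum.cong) auto
  finally have cW: "card W = 3 * card ?C + 1" by simp
  have cV: "card V = card W + card U"
    using fin unfolding VWU by (intro card_Un_disjoint) (auto simp: U_def)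
  \<comment> \<open>No edge joins different K4s away from \<open>a\<close>: if \<open>y\<close> is
    outside \<open>K\<close>, its neighbours \<open>x\<close> and \<open>a\<close> in
    \<open>K\<close> must coincide.\<close>
  have inW: "\<exists>K\<in>?C. x \<in> K \<and> y \<in> K" if xy: "x \<in> W" "y \<in> W" "{x, y} \<in> F" for x y
  proof -
    obtain K L where KL: "K \<in> ?C" "x \<in> K" "L \<in> ?C" "y \<in> L" using xy by (auto simp: W_def)
    show ?thesis
    proof (cases "x = a \<or> y \<in> K")
      case True
      then show ?thesis using KL a by auto
    next
      case False
      then have "y \<noteq> a" using KL a by auto
      then have "{y, a} \<in> F" using clique_adj[OF KL(3,4)] a[OF KL(3)] by simp
      then have "x = a" using K4_nbr_unique[OF KL(1), of y x a] KL a False xy by (simp add: insert_commute)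
      then show ?thesis using False by simp
    qed
  qed
  obtain H where H: "H \<subseteq> edges_on F V" "card H = 2 * card (loose V)"
    "\<And>x y z. {x, y} \<in> H \<Longrightarrow> {y, z} \<in> H \<Longrightarrow> {x, z} \<in> H \<Longrightarrow> False"
    "\<And>e K. e \<in> H \<Longrightarrow> K \<in> cliques F 4 V \<Longrightarrow> \<not> e \<subseteq> K"
    using triangle_free_subgraph[OF V] by metis
  have HF: "e \<in> F" if "e \<in> H" for e using that H(1) by (auto simp: edges_on_def)
  have H2: "card e = 2" if "e \<in> H" for e using HF[OF that] by (rule card_edge)
  have HV: "edges_on H V = H" using H(1) by (auto simp: edges_on_def)
  have HW: "edges_on H W = {}"
  proof (rule ccontr)
    assume "edges_on H W \<noteq> {}"
    then obtain e where e: "e \<in> H" "e \<subseteq> W" by (auto simp: edges_on_def)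
    then obtain x y where xy: "e = {x, y}" using H2[OF e(1)] by (auto simp: card_2_iff)
    then obtain K where "K \<in> ?C" "x \<in> K" "y \<in> K" using inW[of x y] e HF[OF e(1)] by auto
    then show False using H(4)[OF e(1)] xy by simp
  qed
  have deg: "card (nbrs H u W) \<le> card ?C" if u: "u \<in> U" for u
  proof -
    have "nbrs H u W \<subseteq> (\<Union>K\<in>?C. nbrs F u K)" using HF by (auto simp: W_def)
    then have "card (nbrs H u W) \<le> card (\<Union>K\<in>?C. nbrs F u K)"
      using finC finK by (intro card_mono) auto
    also have "\<dots> \<le> (\<Sum>K\<in>?C. card (nbrs F u K))" using finC by (rule card_UN_le)
    also have "\<dots> \<le> (\<Sum>K\<in>?C. 1)"
    proof (rule sum_mono)
      fix K assume K: "K \<in> ?C"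
      then have "u \<notin> K" using u by (auto simp: U_def W_def)
      then show "card (nbrs F u K) \<le> 1" by (rule card_nbrs_K4[OF K])
    qed
    finally show ?thesis by simp
  qed
  have "card (edges_on H V) \<le> card (edges_on H W) + card (edges_on H U) + card ?C * card U"
    unfolding VWU by (rule card_edges_on_Un[OF H2 fin deg[unfolded VWU]])
  moreover have "4 * card (edges_on H U) \<le> (card U)\<^sup>2"
    by (rule mantel[OF fin(2) H2 H(3)])
  ultimately have s: "8 * card (loose V) \<le> 4 * card ?C * card U + (card U)\<^sup>2"
    using HW HV H(2) by simp
  have s0: "card (loose V) = 0" if u: "card U \<le> 1"
  proof (rule ccontr)
    assume "card (loose V) \<noteq> 0"
    then obtain T where T: "T \<in> loose V" by fastforce
    then have T3: "T \<in> cliques F 3 V" by (simp add: loose_def)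
    have "T \<inter> W \<union> T \<inter> U = T" using clique_sub[OF T3] VWU by auto
    then have "3 \<le> card (T \<inter> W) + card (T \<inter> U)"
      using clique_card[OF T3] card_Un_le[of "T \<inter> W" "T \<inter> U"] by simp
    moreover have "card (T \<inter> U) \<le> card U" using fin by (intro card_mono) auto
    ultimately have "\<not> card (T \<inter> W) \<le> 1" using u by linarith
    then obtain x y where xy: "x \<in> T" "x \<in> W" "y \<in> T" "y \<in> W" "x \<noteq> y"
      using card_le_one_if_unique[of "T \<inter> W"] by blast
    then obtain K where K: "K \<in> ?C" "x \<in> K" "y \<in> K" using inW clique_adj[OF T3] by metis
    then have "T \<subseteq> K" using clique3_subset_K4[OF T3] xy by blast
    then show False using T K(1) by (auto simp: loose_def)
  qed
  have "card ?C \<ge> 1" using ne finC by (simp add: Suc_le_eq card_gt_0_iff)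
  then show ?thesis
    using card_cliques3_le[OF V] s s0 cV cW
    by (intro exI[of _ "card ?C"] exI[of _ "card U"] exI[of _ "card (loose V)"]) auto
qed

section \<open>Edge counting with three disjoint K4s\<close>

lemma card_subsets2_K4:
  assumes "K \<in> cliques F 4 V"
  shows "edges_on F K = {e. e \<subseteq> K \<and> card e = 2}" "card (edges_on F K) = 6"
proof -
  have K: "finite K" "card K = 4" using clique_card[OF assms] by (auto intro: card_ge_0_finite)
  show eq: "edges_on F K = {e. e \<subseteq> K \<and> card e = 2}"
    using card_edge clique_adj[OF assms] by (auto simp: edges_on_def card_2_iff)
  show "card (edges_on F K) = 6"
    unfolding eq using n_subsets[OF K(1), of 2] K(2) by (simp add: choose_two)
qed

text \<open>K4s share no edges and \<open>H\<close> has no edge inside a K4. Since there are at most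
  four triangles per K4 plus the loose ones, twice the number of triangles is at most the number of
  edges plus twice the number of K4s.\<close>

lemma card_edges_ge:
  assumes V: "finite V"
  shows "6 * card (cliques F 4 V) + 2 * card (loose V) \<le> card (edges_on F V)"
proof -
  let ?C = "cliques F 4 V" and ?E = "\<Union>K\<in>cliques F 4 V. edges_on F K"
  obtain H where H: "H \<subseteq> edges_on F V" "card H = 2 * card (loose V)"
    "\<And>e K. e \<in> H \<Longrightarrow> K \<in> cliques F 4 V \<Longrightarrow> \<not> e \<subseteq> K"
    using triangle_free_subgraph[OF V] by metis
  have finK: "finite K" if "K \<in> ?C" for K using clique_sub[OF that] V finite_subset by blast
  have "card ?E = (\<Sum>K\<in>?C. card (edges_on F K))"
  proof (rule card_UN_disjoint)
    show "\<forall>K\<in>?C. \<forall>L\<in>?C. K \<noteq> L \<longrightarrow> edges_on F K \<inter> edges_on F L = {}"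
    proof (intro ballI impI, rule ccontr)
      fix K L assume KL: "K \<in> ?C" "L \<in> ?C" "K \<noteq> L" "edges_on F K \<inter> edges_on F L \<noteq> {}"
      then obtain e where e: "e \<in> F" "e \<subseteq> K" "e \<subseteq> L" by (auto simp: edges_on_def)
      then obtain x y where "e = {x, y}" "x \<noteq> y" using card_edge[OF e(1)] by (auto simp: card_2_iff)
      then show False using K4_inter[OF KL(1-3), of x y] e by simp
    qed
  qed (use V finK in auto)
  also have "\<dots> = 6 * card ?C" using card_subsets2_K4(2) by simp
  finally have E: "card ?E = 6 * card ?C" .
  have "?E \<inter> H = {}" using H(3) by (auto simp: edges_on_def)
  moreover have "finite ?E" "finite H" using V finK H(1) finite_subset[OF H(1)] by auto
  ultimately have "card (?E \<union> H) = card ?E + card H" by (intro card_Un_disjoint) auto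
  moreover have "?E \<union> H \<subseteq> edges_on F V" using H(1) clique_sub[of _ F 4 V] by (fastforce simp: edges_on_def)
  then have "card (?E \<union> H) \<le> card (edges_on F V)" using V by (intro card_mono) auto
  ultimately show ?thesis using E H(2) by simp
qed

lemma card_edges_on_le_choose:
  assumes "finite A"
  shows "card (edges_on F A) \<le> card A choose 2"
proof -
  have "card (edges_on F A) \<le> card {e. e \<subseteq> A \<and> card e = 2}"
    using assms card_edge by (intro card_mono) (auto simp: edges_on_def)
  then show ?thesis using n_subsets[OF assms, of 2] by simp
qed

lemma card_nbrs_Un: "card (nbrs F v (A \<union> B)) \<le> card (nbrs F v A) + card (nbrs F v B)"
proof -
  have "nbrs F v (A \<union> B) = nbrs F v A \<union> nbrs F v B" by auto
  then show ?thesis by (simp add: card_Un_le)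
qed

text \<open>At most three vertices remain outside the three K4s, so it suffices to bound the number
  of edges and the number of K4s. Each further K4 meets each of the three in at most one vertex,
  hence uses a vertex of \<open>W\<close>, and no vertex of \<open>W\<close> serves two K4s.\<close>

lemma bound_three_K4s:
  assumes V: "finite V" "card V \<le> 15"
    and K1: "K1 \<in> cliques F 4 V" and K2: "K2 \<in> cliques F 4 (V - K1)"
    and K3: "K3 \<in> cliques F 4 (V - K1 - K2)"
  shows "8 * card (cliques F 3 V) \<le> (card V)\<^sup>2"
proof -
  define W where "W = V - K1 - K2 - K3"
  let ?w = "card W" and ?C = "cliques F 4 V"
  have sub: "K1 \<subseteq> V" "K2 \<subseteq> V - K1" "K3 \<subseteq> V - K1 - K2"
    using clique_sub[OF K1] clique_sub[OF K2] clique_sub[OF K3] by auto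
  have c: "card K1 = 4" "card K2 = 4" "card K3 = 4"
    using clique_card[OF K1] clique_card[OF K2] clique_card[OF K3] by auto
  have fin: "finite K1" "finite K2" "finite K3" "finite W"
    using c V by (auto simp: W_def intro: card_ge_0_finite)
  have VU: "V = K1 \<union> K2 \<union> K3 \<union> W" using sub by (auto simp: W_def)
  have "card (K1 \<union> K2 \<union> K3 \<union> W) = card K1 + card K2 + card K3 + card W"
  proof -
    have "K1 \<inter> K2 = {}" "(K1 \<union> K2) \<inter> K3 = {}" "(K1 \<union> K2 \<union> K3) \<inter> W = {}"
      using sub by (auto simp: W_def)
    then show ?thesis using fin by (simp add: card_Un_disjoint)
  qed
  then have n: "card V = 12 + ?w" using c VU by simp
  then have w3: "?w \<le> 3" using V by simp
  have K2V: "K2 \<in> ?C" and K3V: "K3 \<in> ?C"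
    using K2 K3 cliques_mono[of "V - K1" V F 4] cliques_mono[of "V - K1 - K2" V F 4] by auto
  have d1: "card (nbrs F b K1) \<le> 1" if "b \<notin> K1" for b by (rule card_nbrs_K4[OF K1 that])
  have d2: "card (nbrs F b K2) \<le> 1" if "b \<notin> K2" for b by (rule card_nbrs_K4[OF K2 that])
  have d3: "card (nbrs F b K3) \<le> 1" if "b \<notin> K3" for b by (rule card_nbrs_K4[OF K3 that])
  have d12: "card (nbrs F b (K1 \<union> K2)) \<le> 2" if "b \<notin> K1" "b \<notin> K2" for b
    using card_nbrs_Un[of b K1 K2] d1[OF that(1)] d2[OF that(2)] by linarith
  have d123: "card (nbrs F b (K1 \<union> K2 \<union> K3)) \<le> 3" if "b \<notin> K1" "b \<notin> K2" "b \<notin> K3" for b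
    using card_nbrs_Un[of b "K1 \<union> K2" K3] d12[OF that(1,2)] d3[OF that(3)] by linarith
  have "card (edges_on F (K1 \<union> K2)) \<le> 6 + 6 + 1 * 4"
    using card_edges_on_Un[of F K1 K2 1, OF card_edge fin(1,2) d1] sub c
      card_subsets2_K4(2)[OF K1] card_subsets2_K4(2)[OF K2] by auto
  moreover have "card (edges_on F (K1 \<union> K2 \<union> K3)) \<le> card (edges_on F (K1 \<union> K2)) + 6 + 2 * 4"
    using card_edges_on_Un[of F "K1 \<union> K2" K3 2, OF card_edge _ fin(3) d12] sub c fin
      card_subsets2_K4(2)[OF K3] by auto
  moreover have "card (edges_on F V) \<le> card (edges_on F (K1 \<union> K2 \<union> K3)) + card (edges_on F W) + 3 * ?w"
    unfolding VU
    by (rule card_edges_on_Un[of F "K1 \<union> K2 \<union> K3" W 3, OF card_edge _ fin(4) d123])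
      (use fin in \<open>auto simp: W_def\<close>)
  \<comment> \<open>The 30 is 18 edges inside the three K4s plus at most 4 + 8 between them.\<close>
  ultimately have m: "card (edges_on F V) \<le> 30 + (?w choose 2) + 3 * ?w"
    using card_edges_on_le_choose[OF fin(4)] by linarith
  \<comment> \<open>Two K4s through \<open>x\<close> would give it six neighbours, but it has at
    most three in the K4s \<open>K1\<close>, \<open>K2\<close>, \<open>K3\<close> and two in
    \<open>W\<close>.\<close>
  have uniq: "L = M" if LM: "L \<in> ?C" "M \<in> ?C" "x \<in> W" "x \<in> L" "x \<in> M" for L M x
  proof (rule ccontr)
    assume ne: "L \<noteq> M"
    have f: "finite L" "finite M" using clique_sub[OF LM(1)] clique_sub[OF LM(2)] V finite_subset by blast+
    have "(L - {x}) \<inter> (M - {x}) = {}" using K4_inter[OF LM(1,2) ne] LM by blast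
    then have "card ((L - {x}) \<union> (M - {x})) = 6"
      using f LM clique_card[OF LM(1)] clique_card[OF LM(2)] by (simp add: card_Un_disjoint)
    moreover have "N - {x} \<subseteq> nbrs F x (K1 \<union> K2 \<union> K3 \<union> (W - {x}))" if N: "N \<in> ?C" "x \<in> N" for N
    proof
      fix y assume y: "y \<in> N - {x}"
      then have "y \<in> V" using clique_sub[OF N(1)] by auto
      then have "y \<in> K1 \<union> K2 \<union> K3 \<union> (W - {x})" using y by (auto simp: W_def)
      moreover have "{x, y} \<in> F" using clique_adj[OF N, of y] y by auto
      ultimately show "y \<in> nbrs F x (K1 \<union> K2 \<union> K3 \<union> (W - {x}))" by simp
    qed
    then have "(L - {x}) \<union> (M - {x}) \<subseteq> nbrs F x (K1 \<union> K2 \<union> K3 \<union> (W - {x}))"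
      using LM by (intro Un_least)
    then have "card ((L - {x}) \<union> (M - {x})) \<le> card (nbrs F x (K1 \<union> K2 \<union> K3 \<union> (W - {x})))"
      using fin by (intro card_mono) auto
    moreover have "card (nbrs F x (W - {x})) \<le> card (W - {x})"
      using fin by (intro card_mono) auto
    moreover have "card (W - {x}) \<le> 2" using w3 LM(3) fin by simp
    moreover have "card (nbrs F x (K1 \<union> K2 \<union> K3)) \<le> 3"
      using LM(3) by (intro d123) (auto simp: W_def)
    ultimately show False using card_nbrs_Un[of x "K1 \<union> K2 \<union> K3" "W - {x}"] by linarith
  qed
  have "\<exists>x\<in>W. x \<in> L" if L: "L \<in> ?C" "L \<notin> {K1, K2, K3}" for L
  proof (rule ccontr)
    assume "\<not> ?thesis"
    then have "L = (L \<inter> K1) \<union> (L \<inter> K2) \<union> (L \<inter> K3)" using clique_sub[OF L(1)] VU by auto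
    then have "4 = card ((L \<inter> K1) \<union> (L \<inter> K2) \<union> (L \<inter> K3))" using clique_card[OF L(1)] by simp
    also have "\<dots> \<le> card (L \<inter> K1) + card (L \<inter> K2) + card (L \<inter> K3)"
      by (meson add_le_mono card_Un_le le_trans order_refl)
    also have "card (L \<inter> K) \<le> 1" if "K \<in> ?C" "K \<noteq> L" for K
      using K4_inter[OF that(1) L(1) that(2)] by (intro card_le_one_if_unique) auto
    then have "card (L \<inter> K1) + card (L \<inter> K2) + card (L \<inter> K3) \<le> 1 + 1 + 1"
      using K1 K2V K3V L(2) by (intro add_mono) auto
    finally show False by simp
  qed
  then obtain f where f: "\<And>L. L \<in> ?C - {K1, K2, K3} \<Longrightarrow> f L \<in> W \<and> f L \<in> L"
    by (metis Diff_iff)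
  have "inj_on f (?C - {K1, K2, K3})"
    by (rule inj_onI) (use f uniq in \<open>metis DiffE\<close>)
  then have "card (?C - {K1, K2, K3}) \<le> ?w" using f fin by (intro card_inj_on_le[of f]) auto
  moreover have "card ?C \<le> card (?C - {K1, K2, K3}) + card {K1, K2, K3}"
  proof -
    have "finite {K1, K2, K3}" by simp
    from diff_card_le_card_Diff[OF this, of ?C] show ?thesis by linarith
  qed
  moreover have "card {K1, K2, K3} \<le> 3" by (simp add: card_insert_if)
  ultimately have q: "card ?C \<le> 3 + ?w" by linarith
  have T: "2 * card (cliques F 3 V) \<le> 36 + (?w choose 2) + 5 * ?w"
    using card_cliques3_le[OF V(1)] card_edges_ge[OF V(1)] m q by linarith
  consider "?w = 0" | "?w = 1" | "?w = 2" | "?w = 3" using w3 by linarith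
  then show ?thesis using T n by cases (simp_all add: choose_two)
qed

section \<open>The upper bounds\<close>

lemma triangle_bound:
  assumes "finite V" "card V < 4 \<or> 8 \<le> card V"
  shows "8 * card (cliques F 3 V) \<le> (card V)\<^sup>2"
  using assms
proof (induction "card V" arbitrary: V rule: less_induct)
  case less
  note V = less.prems(1)
  show ?case
  proof (cases "cliques F 4 V = {}")
    case True
    then show ?thesis using bound_without_K4 V by blast
  next
    case ne: False
    then obtain K0 where "K0 \<in> cliques F 4 V" by auto
    then have "4 \<le> card V" using clique_card clique_sub card_mono[OF V] by metis
    then have n8: "8 \<le> card V" using less.prems(2) by auto
    show ?thesis
    proof (cases "\<exists>K\<in>cliques F 4 V. \<exists>L\<in>cliques F 4 V. K \<inter> L = {}")
      case True
      then obtain K L where K: "K \<in> cliques F 4 V" and "L \<in> cliques F 4 V" "K \<inter> L = {}" by auto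
      then have L: "L \<in> cliques F 4 (V - K)" by (auto simp: cliques_def)
      let ?Z = "V - K - L"
      have "finite K" "finite L" "K \<subseteq> V" "L \<subseteq> V - K"
        using clique_sub[OF K] clique_sub[OF L] V finite_subset by blast+
      then have cZ: "card V = card ?Z + 8"
        using clique_card[OF K] clique_card[OF L] n8 by (simp add: card_Diff_subset)
      show ?thesis
      proof (cases "cliques F 4 ?Z = {} \<or> card ?Z < 4 \<or> 8 \<le> card ?Z")
        case True
        have "8 * card (cliques F 3 ?Z) \<le> (card ?Z)\<^sup>2"
        proof (cases "cliques F 4 ?Z = {}")
          case True
          then show ?thesis using V by (intro bound_without_K4) auto
        next
          case False
          then show ?thesis using True cZ V by (intro less.hyps) auto
        qed
        \<comment> \<open>With \<open>z = card ?Z\<close> the step is exact: (z + 8)^2 = z^2 + 8 *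
          (8 + 2 * z).\<close>
        then show ?thesis using remove_two_K4[OF V K L] cZ by (simp add: power2_eq_square algebra_simps)
      next
        case False
        then obtain M where "M \<in> cliques F 4 ?Z" by auto
        then show ?thesis using bound_three_K4s[OF V _ K L] False cZ by simp
      qed
    next
      case False
      then have meet: "K \<inter> L \<noteq> {}" if "K \<in> cliques F 4 V" "L \<in> cliques F 4 V" for K L
        using that by blast
      obtain m u s where *: "m \<ge> 1" "card V = 3 * m + 1 + u" "card (cliques F 3 V) \<le> 4 * m + s"
        "8 * s \<le> 4 * m * u + u\<^sup>2" "u \<le> 1 \<longrightarrow> s = 0"
        using bound_meeting_K4s[OF V ne meet] by metis
      have sq: "(3 * m + 1 + u)\<^sup>2 = 9 * (m * m) + 6 * m + 1 + u\<^sup>2 + 6 * (m * u) + 2 * u"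
        by (simp add: power2_eq_square algebra_simps)
      have "8 * (4 * m + s) \<le> 9 * (m * m) + 6 * m + 1 + u\<^sup>2 + 6 * (m * u) + 2 * u"
      proof -
        \<comment> \<open>Inserting the bound on \<open>8 * s\<close> leaves
          \<open>32 * m \<le> 9 * m * m + 6 * m + 1 + 2 * m * u + 2 * u\<close>, which for at least
          8 vertices fails only at \<open>m = 2\<close>, \<open>u \<le> 2\<close>. There
          \<open>u = 1\<close> has \<open>s = 0\<close> and gives equality, while
          \<open>u = 2\<close> is saved by rounding \<open>8 * s \<le> 20\<close> down to
          \<open>s \<le> 2\<close>.\<close>
        consider "m = 1" | "m = 2" "u = 1" | "m = 2" "u = 2" | "m = 2" "3 \<le> u" | "3 \<le> m"
          using *(1,2) n8 by linarith
        then show ?thesis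
        proof cases
          case 3
          then have "s \<le> 2" using *(4) by (simp add: power2_eq_square)
          then show ?thesis using 3 by simp
        next
          case 5
          then have mm: "3 * m \<le> m * m" by simp
          \<comment> \<open>\<open>p\<close>, \<open>w\<close>, \<open>r\<close> stand for m * m,
            u^2 and m * u, which makes the inequality linear.\<close>
          have lin: "8 * (4 * m + s) \<le> 9 * p + 6 * m + 1 + w + 6 * r + 2 * u"
            if "3 * m \<le> p" "8 * s \<le> 4 * r + w" for p r w :: nat
            using that 5 by simp
          show ?thesis by (rule lin[OF mm *(4)[unfolded mult.assoc]])
        qed (use *(2,4,5) n8 in simp_all)
      qed
      moreover have "8 * card (cliques F 3 V) \<le> 8 * (4 * m + s)" using *(3) by simp
      ultimately show ?thesis unfolding *(2) sq by (rule order_trans[rotated])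
    qed
  qed
qed

text \<open>Disjoint K4s need eight vertices, so all K4s meet. Without a K4 the rounded bounds 2, 3,
  4, 6 are already below the claimed ones.\<close>

lemma triangle_bound_small:
  assumes V: "finite V"
  shows "card V = 4 \<Longrightarrow> card (cliques F 3 V) \<le> 4" "card V = 5 \<Longrightarrow> card (cliques F 3 V) \<le> 4"
    "card V = 6 \<Longrightarrow> card (cliques F 3 V) \<le> 5" "card V = 7 \<Longrightarrow> card (cliques F 3 V) \<le> 8"
proof -
  have "8 * card (cliques F 3 V) \<le> (card V)\<^sup>2 \<or> card V = 4 \<and> card (cliques F 3 V) \<le> 4 \<or>
    card V = 5 \<and> card (cliques F 3 V) \<le> 4 \<or> card V = 6 \<and> card (cliques F 3 V) \<le> 5 \<or>
    card V = 7 \<and> card (cliques F 3 V) \<le> 8" if n: "card V < 8"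
  proof (cases "cliques F 4 V = {}")
    case True
    then show ?thesis using bound_without_K4 V by blast
  next
    case False
    have meet: "K \<inter> L \<noteq> {}" if KL: "K \<in> cliques F 4 V" "L \<in> cliques F 4 V" for K L
    proof
      assume "K \<inter> L = {}"
      moreover have sub: "K \<union> L \<subseteq> V" "finite K" "finite L"
        using clique_sub[OF KL(1)] clique_sub[OF KL(2)] V finite_subset by blast+
      ultimately have "card (K \<union> L) = 8"
        using clique_card[OF KL(1)] clique_card[OF KL(2)] by (simp add: card_Un_disjoint)
      moreover have "card (K \<union> L) \<le> card V" using sub(1) V by (rule card_mono[rotated])
      ultimately show False using n by simp
    qed
    obtain m u s where *: "m \<ge> 1" "card V = 3 * m + 1 + u" "card (cliques F 3 V) \<le> 4 * m + s"
      "8 * s \<le> 4 * m * u + u\<^sup>2" "u \<le> 1 \<longrightarrow> s = 0"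
      using bound_meeting_K4s[OF V False meet] by metis
    \<comment> \<open>These have 4, 5, 6, 7 and 7 vertices and give at most 4, 4, 5, 6 and 8
      triangles.\<close>
    then consider "m = 1" "u = 0" | "m = 1" "u = 1" | "m = 1" "u = 2" | "m = 1" "u = 3" | "m = 2" "u = 0"
      using n by linarith
    then show ?thesis using * by cases simp_all
  qed
  then show "card V = 4 \<Longrightarrow> card (cliques F 3 V) \<le> 4" "card V = 5 \<Longrightarrow> card (cliques F 3 V) \<le> 4"
    "card V = 6 \<Longrightarrow> card (cliques F 3 V) \<le> 5" "card V = 7 \<Longrightarrow> card (cliques F 3 V) \<le> 8"
    by auto
qed

end

section \<open>Passage to the extremal number, and the extremal graphs\<close>

lemma simple_graph_susp_free:
  assumes "simple_graph n E" "\<not> contains_susp_P4 n E"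
  shows "susp_free E"
proof
  fix a p q r s
  show "card e = 2" if "e \<in> E" for e using assms(1) that by (simp add: simple_graph_def)
  assume d: "distinct [a, p, q, r, s]"
    and *: "{a, p} \<in> E" "{a, q} \<in> E" "{a, r} \<in> E" "{a, s} \<in> E" "{p, q} \<in> E" "{q, r} \<in> E" "{r, s} \<in> E"
  have "e \<subseteq> {..<n}" if "e \<in> E" for e using assms(1) that by (simp add: simple_graph_def)
  then have "{a, p, q, r, s} \<subseteq> {..<n}" using * by blast
  moreover have "card {a, p, q, r, s} = 5" using d by simp
  ultimately show False using assms(2) * unfolding contains_susp_P4_def by blast
qed

lemma triangles_eq: "triangles n E = cliques E 3 {..<n}"
  by (simp add: triangles_def cliques_def)

lemma ex_eqI:
  assumes "simple_graph n E" "\<not> contains_susp_P4 n E" "k \<le> num_triangles n E"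
    and upper: "\<And>E. simple_graph n E \<Longrightarrow> susp_free E \<Longrightarrow> card (cliques E 3 {..<n}) \<le> k"
  shows "ex_K3_susp_P4 n = k"
proof -
  let ?S = "{num_triangles n E | E. simple_graph n E \<and> \<not> contains_susp_P4 n E}"
  have le: "x \<le> k" if "x \<in> ?S" for x
    using that upper simple_graph_susp_free by (auto simp: num_triangles_def triangles_eq)
  have in_S: "num_triangles n E \<in> ?S" using assms(1,2) by blast
  then have "num_triangles n E = k" using le[OF in_S] assms(3) by simp
  then have "k \<in> ?S" using in_S by simp
  moreover have "finite ?S" using le by (intro finite_subset[of ?S "{..k}"]) auto
  ultimately show ?thesis unfolding ex_K3_susp_P4_def using le by (intro Max_eqI) auto
qed

definition graph_of :: "nat \<Rightarrow> (nat \<Rightarrow> nat \<Rightarrow> bool) \<Rightarrow> nat set set" where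
  "graph_of n R = {{x, y} | x y. x < n \<and> y < n \<and> x \<noteq> y \<and> (R x y \<or> R y x)}"

lemma graph_of_iff: "{x, y} \<in> graph_of n R \<longleftrightarrow> x < n \<and> y < n \<and> x \<noteq> y \<and> (R x y \<or> R y x)"
  unfolding graph_of_def by (auto simp: doubleton_eq_iff)

lemma simple_graph_of: "simple_graph n (graph_of n R)"
  by (auto simp: simple_graph_def graph_of_def card_2_iff)

lemma not_contains_suspI:
  assumes "\<And>a p q r s. distinct [a, p, q, r, s] \<Longrightarrow> {a, p} \<in> E \<Longrightarrow> {a, q} \<in> E \<Longrightarrow> {a, r} \<in> E \<Longrightarrow>
    {a, s} \<in> E \<Longrightarrow> {p, q} \<in> E \<Longrightarrow> {q, r} \<in> E \<Longrightarrow> {r, s} \<in> E \<Longrightarrow> False"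
  shows "\<not> contains_susp_P4 n E"
proof
  assume "contains_susp_P4 n E"
  then obtain a p q r s where *: "card {a, p, q, r, s} = 5" "{a, p} \<in> E" "{a, q} \<in> E" "{a, r} \<in> E"
    "{a, s} \<in> E" "{p, q} \<in> E" "{q, r} \<in> E" "{r, s} \<in> E"
    unfolding contains_susp_P4_def by blast
  have "distinct [a, p, q, r, s]" by (rule card_distinct) (use *(1) in simp)
  then show False using assms *(2-) by blast
qed

lemma num_triangles_ge:
  assumes "\<And>i. i \<in> I \<Longrightarrow> f i \<in> cliques E 3 {..<n}" "inj_on f I"
  shows "card I \<le> num_triangles n E"
  unfolding num_triangles_def triangles_eq
  using assms by (intro card_inj_on_le[of f]) auto

text \<open>The extremal graph for \<open>n \<ge> 8\<close>: complete bipartite between \<open>{..<2 * p}\<close> and its complement, where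
  \<open>p = (n + 2) div 4\<close>, together with the perfect matching \<open>{2 * i, 2 * i + 1}\<close> of the first part.\<close>

definition big_rel :: "nat \<Rightarrow> nat \<Rightarrow> nat \<Rightarrow> bool" where
  "big_rel p x y \<longleftrightarrow> x < 2 * p \<and> 2 * p \<le> y \<or> y < 2 * p \<and> x div 2 = y div 2"

text \<open>If \<open>a\<close> is in the matched part, each of the disjoint edges
  \<open>q r\<close> and \<open>s t\<close> has an end in that part, which must be the only mate of
  \<open>a\<close>. If \<open>a\<close> is in the other part, its neighbours are all matched
  vertices, and the path \<open>q\<close>, \<open>r\<close>, \<open>s\<close> would lie within one
  pair.\<close>

lemma big_graph_free: "\<not> contains_susp_P4 n (graph_of n (big_rel p))"
proof (rule not_contains_suspI)
  fix a q r s t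
  assume d: "distinct [a, q, r, s, t]"
    and e: "{a, q} \<in> graph_of n (big_rel p)" "{a, r} \<in> graph_of n (big_rel p)"
    "{a, s} \<in> graph_of n (big_rel p)" "{a, t} \<in> graph_of n (big_rel p)"
    "{q, r} \<in> graph_of n (big_rel p)" "{r, s} \<in> graph_of n (big_rel p)" "{s, t} \<in> graph_of n (big_rel p)"
  have adj: "x < 2 * p \<and> 2 * p \<le> y \<or> y < 2 * p \<and> 2 * p \<le> x \<or>
      x < 2 * p \<and> y < 2 * p \<and> x div 2 = y div 2" if "{x, y} \<in> graph_of n (big_rel p)" for x y
    using that by (auto simp: graph_of_iff big_rel_def)
  have half: "x = 2 * (x div 2) \<or> x = 2 * (x div 2) + 1" for x :: nat
    by linarith
  have two: "z = x \<or> z = y" if "x div 2 = y div 2" "x \<noteq> y" "z div 2 = x div 2" for x y z :: nat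
    using half[of x] half[of y] half[of z] that by metis
  show False
  proof (cases "a < 2 * p")
    case True
    have mate: "x div 2 = a div 2" if "{a, x} \<in> graph_of n (big_rel p)" "x < 2 * p" for x
      using adj[OF that(1)] that(2) True by auto
    have "q < 2 * p \<or> r < 2 * p" "s < 2 * p \<or> t < 2 * p" using adj[OF e(5)] adj[OF e(7)] by auto
    then obtain u v where uv: "u \<in> {q, r}" "v \<in> {s, t}" "u div 2 = a div 2" "v div 2 = a div 2"
      using mate[OF e(1)] mate[OF e(2)] mate[OF e(3)] mate[OF e(4)] by blast
    have "u \<noteq> a" "v \<noteq> a" "v \<noteq> u" using uv(1,2) d by auto
    then show False using two[OF uv(3) _ uv(4)[folded uv(3)]] by simp
  next
    case False
    then have qrs: "q div 2 = r div 2" "r div 2 = s div 2"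
      using adj[OF e(1)] adj[OF e(2)] adj[OF e(3)] adj[OF e(5)] adj[OF e(6)] by auto
    have "q \<noteq> r" "s \<noteq> q" "s \<noteq> r" using d by auto
    moreover have "s div 2 = q div 2" using qrs by simp
    ultimately show False using two[OF qrs(1)] by blast
  qed
qed

lemma big_graph_count:
  assumes "2 * p \<le> n"
  shows "p * (n - 2 * p) \<le> num_triangles n (graph_of n (big_rel p))"
proof -
  let ?f = "\<lambda>(i, c). {2 * i, 2 * i + 1, c}"
  have "card ({..<p} \<times> {2 * p..<n}) \<le> num_triangles n (graph_of n (big_rel p))"
  proof (rule num_triangles_ge[of _ ?f])
    fix x assume "x \<in> {..<p} \<times> {2 * p..<n}"
    then obtain i c where x: "x = (i, c)" "i < p" "2 * p \<le> c" "c < n" by auto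
    have "{2 * i, 2 * i + 1, c} \<in> cliques (graph_of n (big_rel p)) 3 {..<n}"
      by (rule clique3I) (use x in \<open>auto simp: graph_of_iff big_rel_def\<close>)
    then show "?f x \<in> cliques (graph_of n (big_rel p)) 3 {..<n}" using x by simp
  next
    show "inj_on ?f ({..<p} \<times> {2 * p..<n})"
    proof (rule inj_onI)
      fix x y assume xy: "x \<in> {..<p} \<times> {2 * p..<n}" "y \<in> {..<p} \<times> {2 * p..<n}" "?f x = ?f y"
      obtain i c j d where e: "x = (i, c)" "y = (j, d)" by fastforce
      have "2 * i \<in> {2 * j, 2 * j + 1, d}" "c \<in> {2 * j, 2 * j + 1, d}" using xy(3) e by auto
      then show "x = y" using xy(1,2) e by auto
    qed
  qed
  then show ?thesis by simp
qed

text \<open>The chosen \<open>p\<close> is an integer nearest to n/4, where p * (n - 2 * p) peaks at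
  n^2/8. The remainders of n^2 modulo 8 are 0, 1, 4, 1, so nothing is lost beyond rounding.\<close>

lemma big_count_arith:
  fixes n :: nat
  defines "p \<equiv> (n + 2) div 4"
  shows "p * (n - 2 * p) = n ^ 2 div 8"
proof -
  define j where "j = n div 4"
  have c: "n = 4 * j \<or> n = 4 * j + 1 \<or> n = 4 * j + 2 \<or> n = 4 * j + 3"
    unfolding j_def by presburger
  have sq: "n ^ 2 div 8 = k" if "n ^ 2 = 8 * k + r" "r < 8" for k r using that by simp
  show ?thesis
    using c
  proof (elim disjE)
    assume 1: "n = 4 * j"
    then have "p = j" unfolding p_def by presburger
    moreover have "n ^ 2 = 8 * (2 * (j * j)) + 0" unfolding 1 by (simp add: power2_eq_square)
    from sq[OF this] have "n ^ 2 div 8 = 2 * (j * j)" by simp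
    ultimately show ?thesis using 1 by simp
  next
    assume 2: "n = 4 * j + 1"
    then have "p = j" unfolding p_def by presburger
    moreover have "n ^ 2 = 8 * (2 * (j * j) + j) + 1" unfolding 2 by (simp add: power2_eq_square algebra_simps)
    from sq[OF this] have "n ^ 2 div 8 = 2 * (j * j) + j" by simp
    ultimately show ?thesis using 2 by (simp add: algebra_simps)
  next
    assume 3: "n = 4 * j + 2"
    then have "p = j + 1" unfolding p_def by presburger
    moreover have "n ^ 2 = 8 * (2 * (j * j) + 2 * j) + 4" unfolding 3 by (simp add: power2_eq_square algebra_simps)
    from sq[OF this] have "n ^ 2 div 8 = 2 * (j * j) + 2 * j" by simp
    ultimately show ?thesis using 3 by (simp add: algebra_simps)
  next
    assume 4: "n = 4 * j + 3"
    then have "p = j + 1" unfolding p_def by presburger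
    moreover have "n ^ 2 = 8 * (2 * (j * j) + 3 * j + 1) + 1" unfolding 4 by (simp add: power2_eq_square algebra_simps)
    from sq[OF this] have "n ^ 2 div 8 = 2 * (j * j) + 3 * j + 1" by simp
    moreover have "n - 2 * (j + 1) = 2 * j + 1" using 4 by simp
    ultimately show ?thesis by (simp add: algebra_simps)
  qed
qed

text \<open>The extremal graphs for \<open>4 \<le> n \<le> 7\<close> are the induced subgraphs on \<open>{..<n}\<close> of the two copies
  \<open>{0, 1, 2, 3}\<close> and \<open>{0, 4, 5, 6}\<close> of the complete graph on four vertices that share the vertex \<open>0\<close>.\<close>

definition small_rel :: "nat \<Rightarrow> nat \<Rightarrow> bool" where
  "small_rel x y \<longleftrightarrow> x < 4 \<and> y < 4 \<or> x \<in> {0, 4, 5, 6} \<and> y \<in> {0, 4, 5, 6}"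

text \<open>The link of 0 splits into two parts without edges between them, and any other link stays
  in one K4. So \<open>a\<close> and the connected path would be five vertices in a set of
  four.\<close>

lemma small_graph_free: "\<not> contains_susp_P4 n (graph_of n small_rel)"
proof (rule not_contains_suspI)
  fix a q r s t
  assume d: "distinct [a, q, r, s, t]"
    and e: "{a, q} \<in> graph_of n small_rel" "{a, r} \<in> graph_of n small_rel"
    "{a, s} \<in> graph_of n small_rel" "{a, t} \<in> graph_of n small_rel"
    "{q, r} \<in> graph_of n small_rel" "{r, s} \<in> graph_of n small_rel" "{s, t} \<in> graph_of n small_rel"
  define A B where AB: "A = {0, 1, 2, 3 :: nat}" "B = {0, 4, 5, 6 :: nat}"
  have adj: "x \<in> A \<and> y \<in> A \<or> x \<in> B \<and> y \<in> B" if "{x, y} \<in> graph_of n small_rel" for x y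
    using that by (auto simp: graph_of_iff small_rel_def AB)
  have meet: "x = 0" if "x \<in> A" "x \<in> B" for x using that by (auto simp: AB)
  have "{a, q, r, s, t} \<subseteq> A \<or> {a, q, r, s, t} \<subseteq> B"
  proof (cases "a = 0")
    case True
    then have "q \<noteq> 0" "r \<noteq> 0" "s \<noteq> 0" "t \<noteq> 0" using d by auto
    then have "{q, r, s, t} \<subseteq> A \<or> {q, r, s, t} \<subseteq> B"
      using adj[OF e(5)] adj[OF e(6)] adj[OF e(7)] meet[of q] meet[of r] meet[of s] meet[of t] by blast
    moreover have "a \<in> A" "a \<in> B" using True by (auto simp: AB)
    ultimately show ?thesis by blast
  next
    case False
    then show ?thesis
      using adj[OF e(1)] adj[OF e(2)] adj[OF e(3)] adj[OF e(4)] meet[of a] by blast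
  qed
  moreover have "card {a, q, r, s, t} = 5" using d by simp
  moreover have "finite A" "finite B" by (simp_all add: AB)
  ultimately have "5 \<le> card A \<or> 5 \<le> card B" by (metis card_mono)
  then show False by (simp add: AB)
qed

lemma small_triangle:
  assumes "x < y" "y < z" "z < n" "z < 4 \<or> x \<in> {0, 4, 5, 6} \<and> y \<in> {4, 5, 6} \<and> z \<in> {4, 5, 6}"
  shows "{x, y, z} \<in> cliques (graph_of n small_rel) 3 {..<n}"
  by (rule clique3I) (use assms in \<open>auto simp: graph_of_iff small_rel_def\<close>)

text \<open>The first bound serves both 4 and 5 vertices: vertex 4 is joined only to 0 at first.
  Vertex 5 completes one more triangle and vertex 6 three more.\<close>

lemma small_graph_count:
  shows "4 \<le> n \<Longrightarrow> 4 \<le> num_triangles n (graph_of n small_rel)"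
    and "6 \<le> n \<Longrightarrow> 5 \<le> num_triangles n (graph_of n small_rel)"
    and "7 \<le> n \<Longrightarrow> 8 \<le> num_triangles n (graph_of n small_rel)"
proof -
  let ?A = "{{0, 1, 2}, {0, 1, 3}, {0, 2, 3}, {1, 2, 3 :: nat}}"
  let ?C = "{{0, 4, 6}, {0, 5, 6}, {4, 5, 6 :: nat}}"
  let ?N = "num_triangles n (graph_of n small_rel)"
  have count: "card I \<le> ?N" if "I \<subseteq> cliques (graph_of n small_rel) 3 {..<n}" for I
    using num_triangles_ge[of I "\<lambda>T. T"] that by auto
  have A: "?A \<subseteq> cliques (graph_of n small_rel) 3 {..<n}" if "4 \<le> n"
    using that by (intro insert_subsetI empty_subsetI small_triangle) auto
  have B: "{0, 4, 5} \<in> cliques (graph_of n small_rel) 3 {..<n}" if "6 \<le> n"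
    using that by (intro small_triangle) auto
  have C: "?C \<subseteq> cliques (graph_of n small_rel) 3 {..<n}" if "7 \<le> n"
    using that by (intro insert_subsetI empty_subsetI small_triangle) auto
  have cA: "card ?A = 4" by (simp add: card_insert_if set_eq_iff; presburger)
  show "4 \<le> n \<Longrightarrow> 4 \<le> ?N" using count[OF A] cA by simp
  have BA: "{0, 4, 5} \<notin> ?A"
  proof
    assume "{0, 4, 5} \<in> ?A"
    then have "4 \<in> \<Union>?A" by blast
    then show False by simp
  qed
  have cB: "card (insert {0, 4, 5} ?A) = 5" using BA cA by (subst card_insert_disjoint) auto
  show "6 \<le> n \<Longrightarrow> 5 \<le> ?N" using count[of "insert {0, 4, 5} ?A"] A B cB by simp
  have "?C \<inter> insert {0, 4, 5} ?A = {}"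
  proof -
    have "6 \<notin> \<Union>(insert {0, 4, 5} ?A)" by simp
    moreover have "6 \<in> T" if "T \<in> ?C" for T using that by auto
    ultimately show ?thesis by blast
  qed
  moreover have "card ?C = 3" by (simp add: card_insert_if set_eq_iff; presburger)
  ultimately have "card (?C \<union> insert {0, 4, 5} ?A) = 8" using cB by (subst card_Un_disjoint) auto
  then show "7 \<le> n \<Longrightarrow> 8 \<le> ?N" using count[of "?C \<union> insert {0, 4, 5} ?A"] A B C by simp
qed

theorem theorem1:
  shows "(\<forall>n::nat. n \<ge> 8 \<longrightarrow> ex_K3_susp_P4 n = n ^ 2 div 8)
    \<and> ex_K3_susp_P4 4 = 4 \<and> ex_K3_susp_P4 5 = 4
    \<and> ex_K3_susp_P4 6 = 5 \<and> ex_K3_susp_P4 7 = 8"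
proof (intro conjI allI impI)
  fix n :: nat assume n: "n \<ge> 8"
  let ?p = "(n + 2) div 4"
  show "ex_K3_susp_P4 n = n ^ 2 div 8"
  proof (rule ex_eqI[OF simple_graph_of big_graph_free])
    have "2 * ?p \<le> n" using n by presburger
    then show "n ^ 2 div 8 \<le> num_triangles n (graph_of n (big_rel ?p))"
      using big_graph_count[of ?p n] big_count_arith[of n] by simp
    show "card (cliques E 3 {..<n}) \<le> n ^ 2 div 8" if "susp_free E" for E :: "nat set set"
      using susp_free.triangle_bound[OF that, of "{..<n}"] n by (simp add: less_eq_div_iff_mult_less_eq)
  qed
next
  show "ex_K3_susp_P4 4 = 4"
    by (rule ex_eqI[OF simple_graph_of small_graph_free small_graph_count(1)])
      (simp_all add: susp_free.triangle_bound_small)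
  show "ex_K3_susp_P4 5 = 4"
    by (rule ex_eqI[OF simple_graph_of small_graph_free small_graph_count(1)])
      (simp_all add: susp_free.triangle_bound_small)
  show "ex_K3_susp_P4 6 = 5"
    by (rule ex_eqI[OF simple_graph_of small_graph_free small_graph_count(2)])
      (simp_all add: susp_free.triangle_bound_small)
  show "ex_K3_susp_P4 7 = 8"
    by (rule ex_eqI[OF simple_graph_of small_graph_free small_graph_count(3)])
      (simp_all add: susp_free.triangle_bound_small)
qed

end
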